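(* Let $a$ and $b$ be integers with $2\leq a\leq b\leq 2a$ and $a+b\equiv 2\pmod 3$. Let $n=b+1-a$ and $k=(2a-b-1)/3$, so that $(a,b)=(n+3k,\,2n+3k-1)$. Then the number of tilings of the $(a,b)$-benzel using only right stones, rising bones, and falling bones is \[ \prod_{j=1}^{k}\frac{(2j)!\,(2j+2n-2)!}{(j+n-1)!\,(j+n+k-1)!}. \]
   Context: Let $\omega=e^{2\pi i/3}$. The hexagonal grid is the tiling of the complex plane $\mathbb{C}$ by regular hexagons of side length $1$ (called cells) in which one cell has vertices $1\pm\omega^j$, $j\in\{0,1,2\}$; the cell centers are the points $1+m\left(\tfrac32-\tfrac{\sqrt3}{2}i\right)+n\sqrt3\, i$ with $m,n\in\mathbb{Z}$, and two cells are adjacent when their centers differ by $\pm\sqrt3 i$ or $\pm\tfrac32\pm\tfrac{\sqrt3}{2}i$. For positive integers $a,b$, the $(a,b)$-benzel is the union of all cells lying entirely within the hexagon with vertices $\omega^j(a\omega+b)$ and $-\omega^j(a+b\omega)$ for $j\in\{0,1,2\}$. The allowed tiles are translates of sets of three cells, with $c$ denoting a cell center: a right stone has centers $\{c,\ c+\sqrt3 i,\ c+\tfrac32+\tfrac{\sqrt3}{2}i\}$ (two vertically stacked cells with a third cell to their right); a left stone has centers $\{c,\ c+\sqrt3 i,\ c-\tfrac32+\tfrac{\sqrt3}{2}i\}$ (two vertically stacked cells with a third cell to their left); a rising bone has centers $\{c,\ c+(\tfrac32+\tfrac{\sqrt3}{2}i),\ c+2(\tfrac32+\tfrac{\sqrt3}{2}i)\}$;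 a falling bone has centers $\{c,\ c+(\tfrac32-\tfrac{\sqrt3}{2}i),\ c+2(\tfrac32-\tfrac{\sqrt3}{2}i)\}$. A tiling of a region is a partition of its cells into such tiles (only the indicated tile types allowed). An empty product equals $1$. *)

theory Defs
  imports "HOL-Analysis.Analysis" "HOL-Number_Theory.Cong"
begin

definition omega :: complex where
  "omega = exp (2 * of_real pi * \<i> / 3)"

section \<open>The hexagonal grid\<close>

definition cell_centers :: "complex set" where
  "cell_centers =
     {1 + of_int m * (3/2 - of_real (sqrt 3) / 2 * \<i>) + of_int n * of_real (sqrt 3) * \<i>
        | m n :: int. True}"

text \<open>The closed regular hexagon of side length 1 centered at \<open>c\<close>; for \<open>c = 1\<close> its
  vertices are \<open>1 \<plusminus> omega ^ j\<close>.\<close>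

definition hex_cell :: "complex \<Rightarrow> complex set" where
  "hex_cell c = convex hull ({c + omega ^ j | j. j < 3} \<union> {c - omega ^ j | j. j < 3})"

definition cells_in :: "complex set \<Rightarrow> complex set set" where
  "cells_in R = {C \<in> hex_cell ` cell_centers. C \<subseteq> R}"

section \<open>Benzels\<close>

text \<open>The six vertices all have modulus \<open>sqrt (a\<^sup>2 - a * b + b\<^sup>2)\<close>, so they are in convex
  position and the hexagon they span is their convex hull.\<close>

definition benzel_hexagon :: "int \<Rightarrow> int \<Rightarrow> complex set" where
  "benzel_hexagon a b = convex hull
     ({omega ^ j * (of_int a * omega + of_int b) | j. j < 3} \<union>
      {- (omega ^ j) * (of_int a + of_int b * omega) | j. j < 3})"

definition benzel :: "int \<Rightarrow> int \<Rightarrow> complex set" where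
  "benzel a b = \<Union> (cells_in (benzel_hexagon a b))"

section \<open>Tiles and tilings\<close>

text \<open>A tile is a set of three cells (not the union of these cells).\<close>

definition right_stone :: "complex \<Rightarrow> complex set set" where
  "right_stone c = hex_cell `
     {c, c + of_real (sqrt 3) * \<i>, c + (3/2 + of_real (sqrt 3) / 2 * \<i>)}"

definition rising_bone :: "complex \<Rightarrow> complex set set" where
  "rising_bone c = hex_cell `
     {c, c + (3/2 + of_real (sqrt 3) / 2 * \<i>), c + 2 * (3/2 + of_real (sqrt 3) / 2 * \<i>)}"

definition falling_bone :: "complex \<Rightarrow> complex set set" where
  "falling_bone c = hex_cell `
     {c, c + (3/2 - of_real (sqrt 3) / 2 * \<i>), c + 2 * (3/2 - of_real (sqrt 3) / 2 * \<i>)}"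

definition right_stones :: "complex set set set" where
  "right_stones = right_stone ` cell_centers"

definition rising_bones :: "complex set set set" where
  "rising_bones = rising_bone ` cell_centers"

definition falling_bones :: "complex set set set" where
  "falling_bones = falling_bone ` cell_centers"

definition tilings :: "complex set set set \<Rightarrow> complex set \<Rightarrow> complex set set set set" where
  "tilings T R = {P. partition_on (cells_in R) P \<and> P \<subseteq> T}"

end

(*
  Read the cells of the benzel row by row, from bottom to top. Every tile meets three consecutive
  rows in one cell each, and going up one row moves it by half a cell to the left or to the right.
  One of any three consecutive steps between rows is forced, so a tiling amounts to a sequence of
  particle configurations, one for every third row: in the lower half of the benzel
  the k particles move to an arbitrary interlacing configuration, in the upper half each particle
  moves by at most one position and one particle leaves at the boundary in every step. Both rules
  turn determinants det (f_j (a_l)) into determinants of the same kind, so the number of tilings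
  is a k x k determinant.

  With u the power series solution of u = x + u^2, the entries of this determinant are coefficients
  of (u + u^2)^j = (2u - x)^j. Modulo polynomials of low degree this is Q_j(x) u with deg Q_j = j - 1
  and leading coefficient 2j up to sign, so the determinant equals 2^k k! times the Hankel
  determinant of the Catalan numbers C_(n+i+j), up to sign. The Hankel determinant is
  triangularized by explicit vectors, whose orthogonality is the vanishing of high differences of
  polynomials of low degree.
*)
theory Submission
  imports Defs "Jordan_Normal_Form.Determinant" "HOL-Computational_Algebra.Formal_Power_Series"
begin

section \<open>Determinants of families of functions\<close>

text \<open>The particles in row \<open>3 * i\<close> are the cells of that row not covered by tiles
  from below. Layers of three rows are peeled off from the bottom, but the determinant grows from
  the top, where nothing is left and the 0 x 0 determinant is 1. In the upper half the number of
  particles varies, so the size of the determinant has to vary with it; this works because the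
  particle that leaves contributes a first row (1, 0, ..., 0). The k upper layers produce the
  functions \<open>shifted_binomial (Suc j) j\<close>, and each of the n + k - 1 lower layers
  applies \<open>partial_sum\<close> once. The bottom row is full, so the resulting determinant is
  taken at the points 0, ..., k - 1; a unitriangular change of rows turns these values into values
  at 0 of further iterates, which are power series coefficients. Signs are never tracked, as a
  cardinality is nonnegative.\<close>

definition fdet :: "nat \<Rightarrow> (nat \<Rightarrow> nat \<Rightarrow> real) \<Rightarrow> real" where
  "fdet k f = Determinant.det (Matrix.mat k k (\<lambda>(i, j). f i j))"

lemma fdet_cong:
  assumes "\<And>i j. i < k \<Longrightarrow> j < k \<Longrightarrow> f i j = g i j"
  shows "fdet k f = fdet k g"
  unfolding fdet_def using assms by (intro arg_cong[where f = Determinant.det] eq_matI) auto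

lemma fdet_0 [simp]: "fdet 0 f = 1"
  unfolding fdet_def by (rule det_dim_zero) auto

lemma fdet_leibniz:
  "fdet k f = (\<Sum>p | p permutes {..<k}. signof p * (\<Prod>i<k. f i (p i)))"
proof -
  have "fdet k f = (\<Sum>p | p permutes {0..<k}. signof p *
      (\<Prod>i = 0..<k. Matrix.mat k k (\<lambda>(i, j). f i j) $$ (i, p i)))"
    unfolding fdet_def by (rule det_def') auto
  also have "\<dots> = (\<Sum>p | p permutes {0..<k}. signof p * (\<Prod>i = 0..<k. f i (p i)))"
  proof (intro sum.cong refl arg_cong2[where f = "(*)"] prod.cong, goal_cases)
    case (1 p i)
    then show ?case using permutes_in_image[of p "{0..<k}" i] by auto
  qed
  finally show ?thesis by (simp add: atLeast0LessThan)
qed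

lemma fdet_mult: "fdet k f * fdet k g = fdet k (\<lambda>i j. \<Sum>t<k. f i t * g t j)"
proof -
  have "fdet k f * fdet k g =
      Determinant.det (Matrix.mat k k (\<lambda>(i, j). f i j) * Matrix.mat k k (\<lambda>(i, j). g i j))"
    unfolding fdet_def by (rule det_mult[symmetric]) auto
  also have "\<dots> = fdet k (\<lambda>i j. \<Sum>t<k. f i t * g t j)"
    unfolding fdet_def
    by (intro arg_cong[where f = Determinant.det] eq_matI)
       (auto simp: scalar_prod_def atLeast0LessThan)
  finally show ?thesis .
qed

lemma fdet_upper:
  assumes "\<And>i j. j < i \<Longrightarrow> i < k \<Longrightarrow> f i j = 0"
  shows "fdet k f = (\<Prod>i<k. f i i)"
proof -
  have "fdet k f = prod_list (diag_mat (Matrix.mat k k (\<lambda>(i, j). f i j)))"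
    unfolding fdet_def by (rule det_upper_triangular) (auto simp: assms)
  then show ?thesis by (simp add: prod_list_diag_prod atLeast0LessThan)
qed

lemma fdet_lower:
  assumes "\<And>i j. i < j \<Longrightarrow> j < k \<Longrightarrow> f i j = 0"
  shows "fdet k f = (\<Prod>i<k. f i i)"
proof -
  have "fdet k f = prod_list (diag_mat (Matrix.mat k k (\<lambda>(i, j). f i j)))"
    unfolding fdet_def by (rule det_lower_triangular[of k]) (auto simp: assms)
  then show ?thesis by (simp add: prod_list_diag_prod atLeast0LessThan)
qed

lemma fdet_equal_rows:
  assumes "i < k" "i' < k" "i \<noteq> i'" "\<And>j. j < k \<Longrightarrow> f i j = f i' j"
  shows "fdet k f = 0"
  unfolding fdet_def using assms
  by (intro det_identical_rows[of _ k i i']) auto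

lemma fdet_zero_row:
  assumes "i < k" "\<And>j. j < k \<Longrightarrow> f i j = 0"
  shows "fdet k f = 0"
  unfolding fdet_leibniz
proof (intro sum.neutral ballI)
  fix p assume "p \<in> {p. p permutes {..<k}}"
  then have "p i < k" using permutes_in_image[of p "{..<k}" i] assms(1) by auto
  then have "(\<Prod>i<k. f i (p i)) = 0" using assms by (intro prod_zero) auto
  then show "signof p * (\<Prod>i<k. f i (p i)) = 0" by simp
qed

lemma fdet_zero_column:
  assumes "j < k" "\<And>i. i < k \<Longrightarrow> f i j = 0"
  shows "fdet k f = 0"
  unfolding fdet_leibniz
proof (intro sum.neutral ballI)
  fix p assume "p \<in> {p. p permutes {..<k}}"
  then have p: "p permutes {..<k}" by simp
  then obtain i where "i < k" "p i = j"
    using permutes_image[OF p] assms(1) by (metis imageE lessThan_iff)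
  then have "(\<Prod>i<k. f i (p i)) = 0" using assms by (intro prod_zero) auto
  then show "signof p * (\<Prod>i<k. f i (p i)) = 0" by simp
qed

lemma fdet_first_row:
  assumes "\<And>j. j < k \<Longrightarrow> f 0 (Suc j) = 0"
  shows "fdet (Suc k) f = f 0 0 * fdet k (\<lambda>i j. f (Suc i) (Suc j))"
proof -
  let ?A = "Matrix.mat (Suc k) (Suc k) (\<lambda>(i, j). f i j)"
  have "fdet (Suc k) f = (\<Sum>j<Suc k. ?A $$ (0, j) * cofactor ?A 0 j)"
    unfolding fdet_def by (rule laplace_expansion_row) auto
  also have "\<dots> = f 0 0 * cofactor ?A 0 0"
    by (subst sum.lessThan_Suc_shift) (simp add: assms)
  also have "cofactor ?A 0 0 = Determinant.det (mat_delete ?A 0 0)"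
    by (simp add: cofactor_def)
  also have "mat_delete ?A 0 0 = Matrix.mat k k (\<lambda>(i, j). f (Suc i) (Suc j))"
    by (rule eq_matI) (auto simp: mat_delete_def)
  finally show ?thesis by (simp add: fdet_def)
qed

text \<open>Multilinearity: row \<open>i\<close> depends on \<open>x i\<close> only, so independent
  choices can be summed inside the rows.\<close>

lemma fdet_sum_rows:
  assumes "\<And>i. i < k \<Longrightarrow> finite (X i)"
  shows "(\<Sum>x \<in> PiE {..<k} X. fdet k (\<lambda>i j. F j (x i))) = fdet k (\<lambda>i j. \<Sum>y\<in>X i. F j y)"
proof -
  have "(\<Sum>x \<in> PiE {..<k} X. fdet k (\<lambda>i j. F j (x i))) =
      (\<Sum>p | p permutes {..<k}. signof p * (\<Sum>x \<in> PiE {..<k} X. \<Prod>i<k. F (p i) (x i)))"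
    unfolding fdet_leibniz by (subst sum.swap) (simp add: sum_distrib_left)
  also have "\<dots> = fdet k (\<lambda>i j. \<Sum>y\<in>X i. F j y)"
    unfolding fdet_leibniz using assms by (subst prod_sum_PiE) auto
  finally show ?thesis .
qed

lemma fdet_diff_rows:
  assumes "\<And>j. j < k \<Longrightarrow> g 0 j = f 0 j"
    and "\<And>i j. Suc i < k \<Longrightarrow> j < k \<Longrightarrow> g (Suc i) j = f (Suc i) j - f i j"
  shows "fdet k g = fdet k f"
proof -
  define L :: "nat \<Rightarrow> nat \<Rightarrow> real" where "L i t = (if t = i then 1 else if Suc t = i then - 1 else 0)" for i t
  have "fdet k L * fdet k f = fdet k (\<lambda>i j. \<Sum>t<k. L i t * f t j)" by (rule fdet_mult)
  also have "\<dots> = fdet k g"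
  proof (rule fdet_cong)
    fix i j assume ij: "i < k" "j < k"
    show "(\<Sum>t<k. L i t * f t j) = g i j"
    proof (cases i)
      case 0
      have "(\<Sum>t<k. L i t * f t j) = (\<Sum>t<k. if t = 0 then f 0 j else 0)"
        by (rule sum.cong) (auto simp: L_def 0)
      then show ?thesis using ij 0 assms(1) by simp
    next
      case (Suc i')
      have "(\<Sum>t<k. L i t * f t j) =
          (\<Sum>t<k. (if t = i then f i j else 0) - (if t = i' then f i' j else 0))"
        by (rule sum.cong) (auto simp: L_def Suc)
      then show ?thesis using ij Suc assms(2) by (simp add: sum_subtractf)
    qed
  qed
  also have "fdet k L = 1" by (subst fdet_lower) (auto simp: L_def)
  finally show ?thesis by simp
qed

text \<open>The reversal matrix \<open>J\<close> is an involution, so its determinant is 1 or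
  -1.\<close>

lemma abs_fdet_reverse_columns:
  "\<bar>fdet k (\<lambda>i j. f i (k - 1 - j))\<bar> = \<bar>fdet k f\<bar>"
proof -
  define J :: "nat \<Rightarrow> nat \<Rightarrow> real" where "J i j = (if i = k - 1 - j then 1 else 0)" for i j
  have *: "fdet k h * fdet k J = fdet k (\<lambda>i j. h i (k - 1 - j))" for h
    unfolding fdet_mult by (rule fdet_cong) (simp add: J_def if_distrib cong: if_cong)
  have "fdet k J * fdet k J = fdet k (\<lambda>i j. if i = j then 1 else 0)"
    unfolding * by (rule fdet_cong) (auto simp: J_def)
  also have "\<dots> = 1" by (subst fdet_upper) auto
  finally have "\<bar>fdet k J\<bar> = 1" by (metis abs_mult abs_one abs_mult_self_eq power2_eq_1_iff power2_eq_square abs_square_eq_1)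
  then show ?thesis using *[of f] by (metis abs_mult mult.right_neutral)
qed

section \<open>The Hankel determinant of Catalan numbers\<close>

lemma alternating_binomial_sum_Suc:
  fixes f :: "nat \<Rightarrow> real"
  shows "(\<Sum>j\<le>Suc r. (-1) ^ j * (Suc r choose j) * f j) =
    (\<Sum>j\<le>r. (-1) ^ j * (r choose j) * (f j - f (Suc j)))"
proof -
  have "(\<Sum>j\<le>Suc r. (-1) ^ j * (Suc r choose j) * f j) =
      f 0 + (\<Sum>j\<le>r. (-1) ^ Suc j * ((r choose j) + (r choose Suc j)) * f (Suc j))"
    by (subst sum.atMost_Suc_shift) simp
  also have "\<dots> = (f 0 + (\<Sum>j\<le>r. (-1) ^ Suc j * (r choose Suc j) * f (Suc j)))
      - (\<Sum>j\<le>r. (-1) ^ j * (r choose j) * f (Suc j))"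
    by (simp add: algebra_simps sum.distrib sum_negf sum_subtractf)
  also have "f 0 + (\<Sum>j\<le>r. (-1) ^ Suc j * (r choose Suc j) * f (Suc j)) =
      (\<Sum>j\<le>Suc r. (-1) ^ j * (r choose j) * f j)"
    by (subst sum.atMost_Suc_shift) simp
  also have "\<dots> = (\<Sum>j\<le>r. (-1) ^ j * (r choose j) * f j)" by simp
  finally show ?thesis by (simp add: algebra_simps sum_subtractf)
qed

text \<open>The sum is an \<open>r\<close>-th difference, and each difference
  \<open>p - pcompose p [:1, 1:]\<close> kills the leading coefficient.\<close>

lemma alternating_binomial_sum_poly:
  fixes p :: "real poly"
  assumes "degree p < r"
  shows "(\<Sum>j\<le>r. (-1) ^ j * (r choose j) * poly p (real j)) = 0"
  using assms
proof (induction r arbitrary: p)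
  case 0
  then show ?case by simp
next
  case (Suc r)
  define q where "q = p - pcompose p [:1, 1:]"
  have q: "poly q (real j) = poly p (real j) - poly p (real (Suc j))" for j
    by (simp add: q_def poly_pcompose add.commute)
  have "(\<Sum>j\<le>Suc r. (-1) ^ j * (Suc r choose j) * poly p (real j)) =
      (\<Sum>j\<le>r. (-1) ^ j * (r choose j) * poly q (real j))"
    unfolding alternating_binomial_sum_Suc q ..
  also have "\<dots> = 0"
  proof (cases "q = 0")
    case False
    have "degree p \<noteq> 0"
    proof
      assume "degree p = 0"
      then obtain c where "p = [:c:]" by (rule degree_eq_zeroE)
      then show False using False by (simp add: q_def)
    qed
    have "coeff q (degree p) = 0"
      using lead_coeff_comp[of "[:1, 1 :: real:]" p] by (simp add: q_def degree_pcompose)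
    moreover have "degree q \<le> degree p"
      unfolding q_def by (rule degree_diff_le) (auto simp: degree_pcompose)
    ultimately have "degree q < degree p"
      using False by (metis leading_coeff_0_iff le_neq_implies_less)
    then show ?thesis using Suc by simp
  qed simp
  finally show ?case .
qed

text \<open>Partial fraction expansion of \<open>fact r / pochhammer z (Suc r)\<close>. It evaluates
  the part of the diagonal entries in \<open>hankel_norm\<close> that differences do not
  annihilate.\<close>

lemma alternating_binomial_sum_inverse:
  fixes z :: real
  assumes "z > 0"
  shows "(\<Sum>j\<le>r. (-1) ^ j * (r choose j) * (1 / (z + real j))) = fact r / pochhammer z (Suc r)"
  using assms
proof (induction r arbitrary: z)
  case 0
  then show ?case by simp
next
  case (Suc r)
  have pos: "pochhammer (z + 1) r > 0" "z > 0" "z + 1 + real r > 0"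
    using Suc.prems by (auto intro: pochhammer_pos)
  have "(\<Sum>j\<le>Suc r. (-1) ^ j * (Suc r choose j) * (1 / (z + real j))) =
      (\<Sum>j\<le>r. (-1) ^ j * (r choose j) * (1 / (z + real j)))
      - (\<Sum>j\<le>r. (-1) ^ j * (r choose j) * (1 / (z + 1 + real j)))"
    unfolding alternating_binomial_sum_Suc by (simp add: algebra_simps sum_subtractf)
  also have "\<dots> = fact r / pochhammer z (Suc r) - fact r / pochhammer (z + 1) (Suc r)"
    using Suc by simp
  also have "pochhammer z (Suc r) = z * pochhammer (z + 1) r" by (rule pochhammer_rec)
  also have "pochhammer (z + 1) (Suc r) = pochhammer (z + 1) r * (z + 1 + real r)"
    by (simp add: pochhammer_Suc)
  also have "fact r / (z * pochhammer (z + 1) r) - fact r / (pochhammer (z + 1) r * (z + 1 + real r))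
      = fact (Suc r) / (z * (pochhammer (z + 1) r * (z + 1 + real r)))"
  proof -
    have "F / (z * A) - F / (A * w) = (w - z) * F / (z * (A * w))"
      if "A > 0" "w > 0" for F A w :: real
      using that pos by (simp add: field_simps)
    from this[OF pos(1,3), of "fact r"] show ?thesis by (simp add: algebra_simps)
  qed
  also have "z * (pochhammer (z + 1) r * (z + 1 + real r)) = pochhammer z (Suc (Suc r))"
    by (simp only: pochhammer_rec[of z "Suc r"] pochhammer_Suc[of "z + 1" r])
  finally show ?case .
qed

section \<open>Vectors that triangularize the Hankel matrix of Catalan numbers\<close>

definition catalan :: "nat \<Rightarrow> real" where
  "catalan m = fact (2 * m) / (fact m * fact (Suc m))"

text \<open>The quotient of (2m)!/m! at m = n + i + j by its value at m = n + j, as a polynomial in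
  j: raising m by one multiplies (2m)!/m! by 2(2m + 1).\<close>

definition oddpoly :: "nat \<Rightarrow> nat \<Rightarrow> real poly" where
  "oddpoly n i = (\<Prod>l<i. [:2 * (2 * real (n + l) + 1), 4:])"

lemma degree_oddpoly: "degree (oddpoly n i) = i"
  unfolding oddpoly_def by (subst degree_prod_eq_sum_degree) auto

lemma poly_oddpoly:
  "poly (oddpoly n i) (real j) * (fact (n + i + j) * fact (2 * n + 2 * j)) =
    fact (2 * (n + i + j)) * fact (n + j)"
proof (induction i)
  case 0
  then show ?case by (simp add: oddpoly_def algebra_simps)
next
  case (Suc i)
  define m where "m = n + i + j"
  have "poly (oddpoly n (Suc i)) (real j) = poly (oddpoly n i) (real j) * (2 * (2 * real m + 1))"
    by (simp add: oddpoly_def m_def algebra_simps)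
  moreover have "n + Suc i + j = Suc m" "2 * (n + Suc i + j) = Suc (Suc (2 * m))"
    by (simp_all add: m_def)
  moreover have "fact (Suc (Suc (2 * m))) = (2 * real m + 2) * ((2 * real m + 1) * fact (2 * m))"
    by (simp add: algebra_simps)
  ultimately have "poly (oddpoly n (Suc i)) (real j) * (fact (n + Suc i + j) * fact (2 * n + 2 * j)) =
      (poly (oddpoly n i) (real j) * (fact m * fact (2 * n + 2 * j))) * ((2 * (2 * real m + 1)) * (real m + 1))"
    by (simp add: algebra_simps)
  also have "\<dots> = fact (Suc (Suc (2 * m))) * fact (n + j)"
    using Suc by (simp add: m_def algebra_simps)
  finally show ?case by (simp add: m_def)
qed

lemma fact_quotient_poly:
  assumes "i \<le> r"
  shows "poly (\<Prod>l\<in>{i..<r}. [:real (n + l + 1), 1:]) (real j) * fact (n + i + j) = fact (n + r + j)"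
  using assms
proof (induction r)
  case (Suc r)
  show ?case
  proof (cases "i = Suc r")
    case False
    then have "i \<le> r" using Suc.prems by simp
    then show ?thesis using Suc.IH
      by (simp add: algebra_simps prod.atLeastLessThan_Suc)
  qed simp
qed simp

text \<open>Chosen so that multiplication by a Catalan number gives a polynomial in j: (n + j)!/(2n
  + 2j)! completes (2m)!/m! to \<open>oddpoly\<close>, and (n + r + j)! cancels the factor (n + i +
  j + 1)! of the denominator if i < r. Sign and binomial turn the pairing into an
  \<open>r\<close>-th difference.\<close>

definition hankel_weight :: "nat \<Rightarrow> nat \<Rightarrow> nat \<Rightarrow> real" where
  "hankel_weight n r j =
    (-1) ^ j * (r choose j) * (fact (n + r + j) * fact (n + j) / fact (2 * n + 2 * j))"

lemma catalan_times_weight: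
  "catalan (n + i + j) * hankel_weight n r j =
    (-1) ^ j * (r choose j) * (poly (oddpoly n i) (real j) * (fact (n + r + j) / fact (n + i + j + 1)))"
proof -
  have "poly (oddpoly n i) (real j) =
      fact (2 * (n + i + j)) * fact (n + j) / (fact (n + i + j) * fact (2 * n + 2 * j))"
    using poly_oddpoly[of n i j] by (simp add: eq_divide_eq)
  then show ?thesis by (simp add: catalan_def hankel_weight_def mult_ac del: fact_Suc)
qed

text \<open>The polynomial has degree at most i + (r - i - 1) = r - 1, too small to survive an
  \<open>r\<close>-th difference.\<close>

lemma hankel_orthogonal:
  assumes "i < r"
  shows "(\<Sum>j\<le>r. catalan (n + i + j) * hankel_weight n r j) = 0"
proof -
  define p where "p = oddpoly n i * (\<Prod>l\<in>{Suc i..<r}. [:real (n + l + 1), 1:])"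
  have "degree p \<le> i + (r - Suc i)"
    unfolding p_def
    by (rule order.trans[OF degree_mult_le]) (simp add: degree_oddpoly degree_prod_eq_sum_degree)
  then have "degree p < r" using assms by simp
  have "catalan (n + i + j) * hankel_weight n r j = (-1) ^ j * (r choose j) * poly p (real j)" for j
  proof -
    have "poly (\<Prod>l\<in>{Suc i..<r}. [:real (n + l + 1), 1:]) (real j) =
        fact (n + r + j) / fact (n + i + j + 1)"
      using fact_quotient_poly[of "Suc i" r n j] assms
      by (simp add: eq_divide_eq del: fact_Suc)
    then show ?thesis by (simp only: catalan_times_weight p_def poly_mult)
  qed
  then show ?thesis using alternating_binomial_sum_poly[OF \<open>degree p < r\<close>] by simp
qed

text \<open>At this point the factor with index l is -2 times the odd number 2(r - l) + 1, so the
  product runs over 3, 5, ..., 2r + 1.\<close>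

lemma poly_oddpoly_reflected:
  "poly (oddpoly n r) (- real (n + r + 1)) = (-1) ^ r * fact (2 * r + 1) / fact r"
proof -
  have "poly (oddpoly n r) (- real (n + r + 1)) = (\<Prod>l<r. - 2 * (2 * real (r - l) + 1))"
    by (auto simp: oddpoly_def poly_prod of_nat_diff algebra_simps intro!: prod.cong)
  also have "\<dots> = (\<Prod>l<r. - 2 * (2 * real (Suc l) + 1))"
    by (subst prod.nat_diff_reindex[symmetric]) (auto intro!: prod.cong simp: Suc_diff_Suc)
  also have "\<dots> = (-1) ^ r * fact (2 * r + 1) / fact r"
  proof (induction r)
    case (Suc r)
    have "fact (2 * Suc r + 1) = (2 * real r + 3) * (2 * real r + 2) * fact (2 * r + 1)"
      by (simp add: algebra_simps)
    then have "(-1) ^ Suc r * fact (2 * Suc r + 1) / fact (Suc r) =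
        ((-1) ^ r * fact (2 * r + 1) / fact r) *
        (- ((2 * real r + 3) * (2 * real r + 2)) / (real r + 1))"
      by (simp del: fact_Suc add: fact_Suc[of r] add.commute mult_ac)
    also have "- ((2 * real r + 3) * (2 * real r + 2)) / (real r + 1) = - 2 * (2 * real (Suc r) + 1)"
      by (simp add: divide_simps) (simp add: algebra_simps)
    finally show ?case using Suc by (simp del: fact_Suc)
  qed simp
  finally show ?thesis .
qed

text \<open>For i = r the factorials leave a pole 1/(z + j). Division with remainder splits off a
  polynomial of lower degree, which the difference annihilates, and only the value at
  \<open>- z\<close> contributes.\<close>

lemma hankel_norm:
  "(\<Sum>j\<le>r. catalan (n + r + j) * hankel_weight n r j) =
    (-1) ^ r * fact (2 * r + 1) * fact (n + r) / fact (n + 2 * r + 1)"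
proof -
  define z where "z = real (n + r + 1)"
  have "z > 0" by (simp add: z_def)
  define p where "p = oddpoly n r"
  define q where "q = synthetic_div p (- z)"
  have p: "poly p x = (x + z) * poly q x + poly p (- z)" for x
  proof -
    have "poly p x = poly ([:- (- z), 1:] * synthetic_div p (- z) + [:poly p (- z):]) x"
      by (subst synthetic_div_correct') simp
    then show ?thesis by (simp add: q_def algebra_simps)
  qed
  have q0: "(\<Sum>j\<le>r. (-1) ^ j * (r choose j) * poly q (real j)) = 0"
  proof (cases "r = 0")
    \<comment> \<open>A zeroth difference annihilates nothing, but here \<open>p\<close> is constant
      and \<open>q\<close> is zero.\<close>
    case True
    then show ?thesis by (simp add: q_def p_def oddpoly_def one_pCons)
  next
    case False
    then have "degree q < r" by (simp add: q_def p_def degree_synthetic_div degree_oddpoly)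
    then show ?thesis by (rule alternating_binomial_sum_poly)
  qed
  have "catalan (n + r + j) * hankel_weight n r j =
      (-1) ^ j * (r choose j) * poly q (real j) +
      poly p (- z) * ((-1) ^ j * (r choose j) * (1 / (z + real j)))" for j
  proof -
    have "fact (n + r + j) / fact (n + r + j + 1) = 1 / (z + real j)"
      by (simp add: z_def add_ac)
    moreover have "poly p (real j) * (1 / (z + real j)) =
        poly q (real j) + poly p (- z) * (1 / (z + real j))"
      using \<open>z > 0\<close> by (subst p) (simp add: field_simps)
    ultimately show ?thesis
      by (simp only: catalan_times_weight p_def[symmetric]) (simp add: algebra_simps)
  qed
  then have "(\<Sum>j\<le>r. catalan (n + r + j) * hankel_weight n r j) =
      (\<Sum>j\<le>r. (-1) ^ j * (r choose j) * poly q (real j)) +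
      poly p (- z) * (\<Sum>j\<le>r. (-1) ^ j * (r choose j) * (1 / (z + real j)))"
    by (simp only: sum.distrib sum_distrib_left)
  also have "\<dots> = poly p (- z) * (fact r / pochhammer z (Suc r))"
    unfolding q0 alternating_binomial_sum_inverse[OF \<open>z > 0\<close>] by simp
  also have "pochhammer z (Suc r) = fact (n + 2 * r + 1) / fact (n + r)"
  proof -
    have z: "1 + real (n + r) = z" by (simp add: z_def)
    have "(fact (n + r + Suc r) :: real) = fact (n + r) * pochhammer z (Suc r)"
      using pochhammer_product'[of "1 :: real" "n + r" "Suc r"]
      unfolding z pochhammer_fact[symmetric, where 'a = real] .
    moreover have "n + r + Suc r = n + 2 * r + 1" by simp
    ultimately have "(fact (n + 2 * r + 1) :: real) = fact (n + r) * pochhammer z (Suc r)"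
      by metis
    then show ?thesis by (metis fact_nonzero nonzero_mult_div_cancel_left)
  qed
  finally show ?thesis
    using poly_oddpoly_reflected[of n r] by (simp add: p_def z_def)
qed

text \<open>By orthogonality the product with the upper triangular matrix of weights is lower
  triangular, so the determinant is a quotient of two diagonal products.\<close>

lemma hankel_catalan:
  "fdet k (\<lambda>i j. catalan (n + i + j)) =
    (\<Prod>r<k. fact (2 * r + 1) * fact (2 * n + 2 * r) / (fact (n + 2 * r) * fact (n + 2 * r + 1)))"
proof -
  let ?H = "\<lambda>i j. catalan (n + i + j)" and ?W = "\<lambda>j r. hankel_weight n r j"
  have HW: "(\<Sum>t<k. ?H i t * ?W t r) = (\<Sum>t\<le>r. ?H i t * hankel_weight n r t)" if "r < k" for i r
    using that by (intro sum.mono_neutral_right) (auto simp: hankel_weight_def)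
  have "fdet k ?H * fdet k ?W = fdet k (\<lambda>i r. \<Sum>t<k. ?H i t * ?W t r)" by (rule fdet_mult)
  also have "\<dots> = (\<Prod>r<k. \<Sum>t<k. ?H r t * ?W t r)"
    by (rule fdet_lower) (simp add: HW hankel_orthogonal)
  also have "\<dots> = (\<Prod>r<k. (-1) ^ r * fact (2 * r + 1) * fact (n + r) / fact (n + 2 * r + 1))"
    by (rule prod.cong) (simp_all add: HW hankel_norm)
  also have "\<dots> = (\<Prod>r<k. fact (2 * r + 1) * fact (2 * n + 2 * r) / (fact (n + 2 * r) * fact (n + 2 * r + 1)))
      * (\<Prod>r<k. hankel_weight n r r)"
    unfolding prod.distrib[symmetric]
  proof (rule prod.cong, rule refl)
    fix r
    have *: "n + r + r = n + 2 * r" by simp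
    show "(-1) ^ r * fact (2 * r + 1) * fact (n + r) / fact (n + 2 * r + 1) =
        fact (2 * r + 1) * fact (2 * n + 2 * r) / (fact (n + 2 * r) * fact (n + 2 * r + 1)) *
        hankel_weight n r r"
      unfolding hankel_weight_def * by (simp del: fact_Suc)
  qed
  also have "(\<Prod>r<k. hankel_weight n r r) = fdet k ?W"
    by (rule fdet_upper[symmetric]) (simp add: hankel_weight_def)
  finally have "fdet k ?H * fdet k ?W = 
     (\<Prod>r<k. fact (2 * r + 1) * fact (2 * n + 2 * r) / (fact (n + 2 * r) * fact (n + 2 * r + 1))) * fdet k ?W" .
  moreover have "fdet k ?W \<noteq> 0"
    by (subst fdet_upper) (auto simp: hankel_weight_def)
  ultimately show ?thesis by simp
qed

section \<open>Iterated partial sums\<close>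

unbundle no vec_syntax
no_notation Matrix.vec_index (infixl "$" 100)
unbundle fps_syntax

text \<open>The bound is \<open>Suc a\<close> because in the lower half a particle at
  \<open>a\<close> can be followed by one at \<open>a + 1\<close>.\<close>

definition partial_sum :: "(nat \<Rightarrow> real) \<Rightarrow> nat \<Rightarrow> real" where
  "partial_sum f a = (\<Sum>y\<le>Suc a. f y)"

text \<open>The coefficients of X^j (1 + X)^t. For \<open>x < j\<close> truncated subtraction would
  yield \<open>t choose 0\<close>, hence the case distinction.\<close>

definition shifted_binomial :: "nat \<Rightarrow> nat \<Rightarrow> nat \<Rightarrow> real" where
  "shifted_binomial t j x = (if x < j then 0 else real (t choose (x - j)))"

lemma shifted_binomial_0: "shifted_binomial 0 j x = (if x = j then 1 else 0)"
  by (auto simp: shifted_binomial_def)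

lemma shifted_binomial_Suc:
  "shifted_binomial (Suc t) j x = shifted_binomial t j x + shifted_binomial t (Suc j) x"
proof (cases "x \<le> j")
  case True
  then show ?thesis by (auto simp: shifted_binomial_def)
next
  case False
  then obtain d where "x = j + Suc d" by (metis add_Suc_right less_imp_Suc_add not_le)
  then show ?thesis by (simp add: shifted_binomial_def)
qed

lemma shifted_binomial_shift: "shifted_binomial t (Suc j) (Suc x) = shifted_binomial t j x"
  by (simp add: shifted_binomial_def)

lemma fps_shifted_binomial:
  "Abs_fps (shifted_binomial t j) = fps_X ^ j * (1 + fps_X) ^ t"
proof (induction t arbitrary: j)
  case 0
  show ?case by (rule fps_ext) (simp add: shifted_binomial_0 fps_X_power_nth)
next
  case (Suc t)
  have "Abs_fps (shifted_binomial (Suc t) j) =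
      Abs_fps (shifted_binomial t j) + Abs_fps (shifted_binomial t (Suc j))"
    by (rule fps_ext) (simp add: shifted_binomial_Suc)
  then show ?case by (simp add: Suc algebra_simps)
qed

text \<open>Kernel of the \<open>l\<close>-fold \<open>partial_sum\<close>: it counts walks of
  \<open>l\<close> steps from \<open>x\<close> to \<open>y\<close> that stay nonnegative and rise by
  at most one per step.\<close>

primrec ballot :: "nat \<Rightarrow> nat \<Rightarrow> nat \<Rightarrow> real" where
  "ballot 0 x y = (if y = x then 1 else 0)"
| "ballot (Suc l) x y = (\<Sum>z\<le>Suc x. ballot l z y)"

lemma ballot_eq_0: "y > x + l \<Longrightarrow> ballot l x y = 0"
  by (induction l arbitrary: x) auto

lemma ballot_eq_1: "ballot l x (x + l) = 1"
proof (induction l arbitrary: x)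
  case (Suc l)
  have "(\<Sum>z\<le>Suc x. ballot l z (Suc (x + l))) = (\<Sum>z\<in>{Suc x}. ballot l z (Suc (x + l)))"
    by (rule sum.mono_neutral_right) (auto intro!: ballot_eq_0)
  then show ?case using Suc[of "Suc x"] by simp
qed simp

lemma funpow_partial_sum:
  "x + l < m \<Longrightarrow> (partial_sum ^^ l) g x = (\<Sum>y<m. ballot l x y * g y)"
proof (induction l arbitrary: x)
  case 0
  have "(\<Sum>y<m. ballot 0 x y * g y) = (\<Sum>y<m. if y = x then g x else 0)"
    by (rule sum.cong) auto
  then show ?case using 0 by simp
next
  case (Suc l)
  have "(partial_sum ^^ Suc l) g x = (\<Sum>z\<le>Suc x. (partial_sum ^^ l) g z)"
    by (simp add: partial_sum_def)
  also have "\<dots> = (\<Sum>z\<le>Suc x. \<Sum>y<m. ballot l z y * g y)"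
    using Suc.prems by (intro sum.cong Suc.IH) auto
  also have "\<dots> = (\<Sum>y<m. ballot (Suc l) x y * g y)"
    by (subst sum.swap) (simp only: ballot.simps sum_distrib_right)
  finally show ?case .
qed

section \<open>The Catalan power series and coefficient extraction\<close>

definition catalan_fps :: "real fps" where
  "catalan_fps = fps_X * Abs_fps catalan"

lemma catalan_fps_nth: "catalan_fps $ m = (if m = 0 then 0 else catalan (m - 1))"
  by (simp add: catalan_fps_def)

text \<open>Coefficientwise this is the recurrence (m + 2) C(m + 1) = (4m + 2) C(m), which is
  immediate from the closed form.\<close>

lemma catalan_fps_ode: "(1 - 4 * fps_X) * fps_deriv catalan_fps = 1 - 2 * catalan_fps"
proof (rule fps_ext)
  fix m
  show "((1 - 4 * fps_X) * fps_deriv catalan_fps) $ m = (1 - 2 * catalan_fps) $ m"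
  proof (cases m)
    case 0
    then show ?thesis by (simp add: algebra_simps catalan_fps_nth catalan_def)
  next
    case (Suc m')
    have "real (Suc (Suc m')) * catalan (Suc m') = (4 * real m' + 2) * catalan m'"
    proof -
      have "(fact (2 * Suc m') :: real) = (2 * real m' + 2) * (2 * real m' + 1) * fact (2 * m')"
        by (simp add: algebra_simps)
      then have "catalan (Suc m') =
          (2 * real m' + 2) * (2 * real m' + 1) * fact (2 * m') /
          (real (Suc m') * fact m' * (real (Suc (Suc m')) * fact (Suc m')))"
        unfolding catalan_def by (simp only: fact_Suc[of m'] fact_Suc[of "Suc m'"] of_nat_mult)
      then show ?thesis by (simp add: catalan_def divide_simps) (simp add: algebra_simps)
    qed
    then show ?thesis
      by (simp add: Suc left_diff_distrib mult.assoc numeral_fps_const catalan_fps_nth algebra_simps)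
  qed
qed

text \<open>The difference \<open>v\<close> of (1 - 2u)^2 and 1 - 4X solves a homogeneous linear
  differential equation and has constant term 0, so it vanishes.\<close>

lemma catalan_fps_square: "catalan_fps ^ 2 = catalan_fps - fps_X"
proof -
  define v where "v = (1 - 2 * catalan_fps) ^ 2 - (1 - 4 * fps_X)"
  have "(1 - 4 * fps_X) * fps_deriv v =
      - 4 * (1 - 2 * catalan_fps) * ((1 - 4 * fps_X) * fps_deriv catalan_fps) + 4 * (1 - 4 * fps_X)"
    by (simp add: v_def fps_deriv_power power2_eq_square algebra_simps)
  also have "\<dots> = - 4 * v"
    unfolding catalan_fps_ode by (simp add: v_def power2_eq_square algebra_simps)
  finally have ode: "(1 - 4 * fps_X) * fps_deriv v = - 4 * v" .
  have "v $ m = 0" for m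
  proof (induction m)
    case 0
    then show ?case by (simp add: v_def power2_eq_square catalan_fps_nth)
  next
    case (Suc m)
    have "((1 - 4 * fps_X) * fps_deriv v) $ m = 0" unfolding ode using Suc by (simp add: numeral_fps_const)
    moreover have "((1 - 4 * fps_X) * fps_deriv v) $ m = real (Suc m) * v $ Suc m"
      using Suc by (cases m) (simp_all add: left_diff_distrib mult.assoc numeral_fps_const)
    ultimately show ?case by simp
  qed
  then have "v = 0" by (simp add: fps_eq_iff)
  then have "4 * (catalan_fps ^ 2 - (catalan_fps - fps_X)) = 0"
    by (simp add: v_def power2_eq_square algebra_simps)
  then show ?thesis by (simp add: numeral_fps_const)
qed

text \<open>Kernel method: the series of the partial sums carries the factor X(1 - X), which becomes
  X when u is substituted, since u(1 - u) = X. One partial sum is thus a shift of the coefficients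
  of u F(u).\<close>

lemma funpow_partial_sum_0:
  "(partial_sum ^^ m) f 0 = (catalan_fps * (Abs_fps f oo catalan_fps)) $ Suc m"
proof (induction m arbitrary: f)
  case 0
  show ?case by (simp add: fps_mult_nth_1 catalan_fps_nth catalan_def)
next
  case (Suc m)
  define u where "u = catalan_fps"
  define F where "F = Abs_fps f"
  \<comment> \<open>\<open>F'\<close> belongs to the summed sequence; it is not a
    derivative.\<close>
  define F' where "F' = Abs_fps (partial_sum f)"
  have u0: "u $ 0 = 0" by (simp add: u_def catalan_fps_nth)
  have "fps_X * (1 - fps_X) * F' = F - fps_const (f 0) * (1 - fps_X)"
  proof (rule fps_ext)
    fix l
    consider "l = 0" | "l = 1" | l' where "l = Suc (Suc l')"
      by (metis One_nat_def not0_implies_Suc)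
    then show "(fps_X * (1 - fps_X) * F') $ l = (F - fps_const (f 0) * (1 - fps_X)) $ l"
      by cases (simp_all add: mult.assoc left_diff_distrib F_def F'_def partial_sum_def right_diff_distrib)
  qed
  then have "(fps_X * (1 - fps_X) * F') oo u = (F - fps_const (f 0) * (1 - fps_X)) oo u" by simp
  then have *: "u * (1 - u) * (F' oo u) = (F oo u) - fps_const (f 0) * (1 - u)"
    by (simp add: fps_compose_mult_distrib[OF u0] fps_compose_sub_distrib u0)
  have x: "u * (1 - u) = fps_X"
    using catalan_fps_square by (simp add: u_def power2_eq_square algebra_simps)
  \<comment> \<open>The factor u turns the correction term into a multiple of X, invisible in the
    coefficients read off below.\<close>
  have "fps_X * (u * (F' oo u)) = u * (u * (1 - u) * (F' oo u))"
    unfolding x by (simp add: mult_ac)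
  also have "\<dots> = u * (F oo u) - fps_const (f 0) * (u * (1 - u))"
    unfolding * by (simp add: algebra_simps)
  finally have "fps_X * (u * (F' oo u)) = u * (F oo u) - fps_const (f 0) * fps_X" unfolding x .
  then have "(fps_X * (u * (F' oo u))) $ Suc (Suc m) = (u * (F oo u) - fps_const (f 0) * fps_X) $ Suc (Suc m)"
    by simp
  then have "(u * (F' oo u)) $ Suc m = (u * (F oo u)) $ Suc (Suc m)"
    by simp
  moreover have "(partial_sum ^^ Suc m) f 0 = (u * (F' oo u)) $ Suc m"
    using Suc[of "partial_sum f"] by (simp add: funpow_Suc_right u_def F'_def del: funpow.simps)
  ultimately show ?case by (simp add: u_def F_def)
qed

text \<open>The induction multiplies by 2u - X and reduces u^2 to u - X. The top coefficient of
  \<open>P\<close> is carried along because it enters the top coefficient of the next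
  \<open>Q\<close>.\<close>

lemma power_catalan_fps_linear:
  "\<exists>P Q. (catalan_fps + catalan_fps ^ 2) ^ Suc j = P + Q * catalan_fps \<and>
     (\<forall>t > Suc j. P $ t = 0) \<and> P $ Suc j = (-1) ^ Suc j \<and>
     (\<forall>t > j. Q $ t = 0) \<and> Q $ j = (-1) ^ j * 2 * real (Suc j)"
proof (induction j)
  case 0
  show ?case
    by (rule exI[of _ "- fps_X"], rule exI[of _ 2])
       (auto simp: catalan_fps_square numeral_fps_const)
next
  case (Suc j)
  let ?u = catalan_fps
  obtain P Q where PQ: "(?u + ?u ^ 2) ^ Suc j = P + Q * ?u"
    "\<And>t. t > Suc j \<Longrightarrow> P $ t = 0" "P $ Suc j = (-1) ^ Suc j"
    "\<And>t. t > j \<Longrightarrow> Q $ t = 0" "Q $ j = (-1) ^ j * 2 * real (Suc j)"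
    using Suc by blast
  define P' where "P' = - (fps_X * (P + fps_const 2 * Q))"
  define Q' where "Q' = fps_const 2 * P + fps_const 2 * Q - fps_X * Q"
  have "(?u + ?u ^ 2) ^ Suc (Suc j) = (2 * ?u - fps_X) * (P + Q * ?u)"
    unfolding power_Suc[of _ "Suc j"] PQ(1) by (simp add: catalan_fps_square algebra_simps)
  also have "\<dots> = 2 * ?u * P - fps_X * P - fps_X * Q * ?u + 2 * Q * ?u ^ 2"
    by (simp add: algebra_simps power2_eq_square)
  also have "\<dots> = P' + Q' * ?u"
    by (simp add: P'_def Q'_def catalan_fps_square numeral_fps_const algebra_simps)
  finally have "(?u + ?u ^ 2) ^ Suc (Suc j) = P' + Q' * ?u" .
  moreover have "P' $ t = 0" if "t > Suc (Suc j)" for t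
    using that PQ(2)[of "t - 1"] PQ(4)[of "t - 1"] by (cases t) (auto simp: P'_def)
  moreover have "P' $ Suc (Suc j) = (-1) ^ Suc (Suc j)"
    using PQ(3) PQ(4)[of "Suc j"] by (simp add: P'_def)
  moreover have "Q' $ t = 0" if "t > Suc j" for t
    using that PQ(2)[of t] PQ(4)[of "t - 1"] PQ(4)[of t] by (cases t) (auto simp: Q'_def)
  moreover have "Q' $ Suc j = (-1) ^ Suc j * 2 * real (Suc (Suc j))"
    using PQ(3,5) PQ(4)[of "Suc j"] by (simp add: Q'_def algebra_simps)
  ultimately show ?case by blast
qed

text \<open>After multiplication by the unitriangular matrix of \<open>ballot\<close> numbers, the
  matrix factors into a Hankel matrix with reversed columns and the triangular matrix of
  coefficients of the \<open>Q j\<close>.\<close>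

lemma abs_fdet_partial_sums:
  assumes "n \<ge> 1"
  shows "\<bar>fdet k (\<lambda>i j. (partial_sum ^^ (n + k - 1)) (shifted_binomial (Suc j) j) i)\<bar> =
    2 ^ k * fact k * \<bar>fdet k (\<lambda>i j. catalan (n + i + j))\<bar>"
proof -
  let ?u = catalan_fps and ?f = "\<lambda>j. shifted_binomial (Suc j) j"
  have "\<forall>j. \<exists>Q. \<exists>P. (?u + ?u ^ 2) ^ Suc j = P + Q * ?u \<and> (\<forall>t > Suc j. P $ t = 0) \<and>
     (\<forall>t > j. Q $ t = 0) \<and> Q $ j = (-1) ^ j * 2 * real (Suc j)"
    using power_catalan_fps_linear by metis
  then obtain Q where Q: "\<And>j. \<exists>P. (?u + ?u ^ 2) ^ Suc j = P + Q j * ?u \<and> (\<forall>t > Suc j. P $ t = 0)"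
    "\<And>j t. t > j \<Longrightarrow> Q j $ t = 0" "\<And>j. Q j $ j = (-1) ^ j * 2 * real (Suc j)"
    by metis
  have coeff: "(partial_sum ^^ (n + k - 1 + i)) (?f j) 0 =
      (\<Sum>t<k. catalan (n + i + (k - 1 - t)) * Q j $ t)" if "j < k" for i j
  proof -
    let ?m = "n + k - 1 + i"
    obtain P where P: "(?u + ?u ^ 2) ^ Suc j = P + Q j * ?u" "\<And>t. t > Suc j \<Longrightarrow> P $ t = 0"
      using Q(1) by blast
    have "Abs_fps (?f j) oo ?u = ?u ^ j * (1 + ?u) ^ Suc j"
      unfolding fps_shifted_binomial
      by (simp add: fps_compose_mult_distrib fps_compose_power[symmetric] fps_compose_add_distrib
          catalan_fps_nth)
    then have "?u * (Abs_fps (?f j) oo ?u) = (?u + ?u ^ 2) ^ Suc j"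
    proof -
      have "?u + ?u ^ 2 = ?u * (1 + ?u)" by (simp add: power2_eq_square distrib_left)
      then show ?thesis using \<open>Abs_fps (?f j) oo ?u = _\<close>
        by (simp only: power_mult_distrib power_Suc mult_ac)
    qed
    then have "(partial_sum ^^ ?m) (?f j) 0 = (P + Q j * ?u) $ Suc ?m"
      by (simp only: funpow_partial_sum_0 P(1))
    \<comment> \<open>The index n + k + i exceeds the degree bound j + 1 of \<open>P\<close>,
      because j < k and n is positive.\<close>
    also have "\<dots> = (Q j * ?u) $ Suc ?m"
      using that assms by (simp add: P(2))
    also have "\<dots> = (\<Sum>t\<le>Suc ?m. Q j $ t * ?u $ (Suc ?m - t))"
      by (simp add: fps_mult_nth atLeast0AtMost)
    also have "\<dots> = (\<Sum>t<k. Q j $ t * ?u $ (Suc ?m - t))"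
      using that assms by (intro sum.mono_neutral_right) (auto simp: Q(2))
    also have "\<dots> = (\<Sum>t<k. catalan (n + i + (k - 1 - t)) * Q j $ t)"
    proof (rule sum.cong, rule refl)
      fix t assume "t \<in> {..<k}"
      then have "Suc ?m - t = Suc (n + i + (k - 1 - t))" using assms by auto
      then show "Q j $ t * ?u $ (Suc ?m - t) = catalan (n + i + (k - 1 - t)) * Q j $ t"
        by (simp add: catalan_fps_nth)
    qed
    finally show ?thesis .
  qed
  let ?D = "fdet k (\<lambda>i j. (partial_sum ^^ (n + k - 1)) (?f j) i)"
  have "fdet k (\<lambda>l. ballot l 0) * ?D =
      fdet k (\<lambda>i j. \<Sum>t<k. ballot i 0 t * (partial_sum ^^ (n + k - 1)) (?f j) t)"
    by (rule fdet_mult)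
  also have "\<dots> = fdet k (\<lambda>i j. \<Sum>t<k. catalan (n + i + (k - 1 - t)) * Q j $ t)"
  proof (rule fdet_cong)
    fix i j assume "i < k" "j < k"
    then have "(\<Sum>t<k. ballot i 0 t * (partial_sum ^^ (n + k - 1)) (?f j) t) =
        (partial_sum ^^ i) ((partial_sum ^^ (n + k - 1)) (?f j)) 0"
      by (simp add: funpow_partial_sum)
    also have "\<dots> = (partial_sum ^^ (n + k - 1 + i)) (?f j) 0"
      by (simp add: funpow_add add.commute[of _ i])
    finally show "(\<Sum>t<k. ballot i 0 t * (partial_sum ^^ (n + k - 1)) (?f j) t) =
        (\<Sum>t<k. catalan (n + i + (k - 1 - t)) * Q j $ t)"
      using coeff \<open>j < k\<close> by simp
  qed
  also have "\<dots> = fdet k (\<lambda>i t. catalan (n + i + (k - 1 - t))) * fdet k (\<lambda>t j. Q j $ t)"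
    by (rule fdet_mult[symmetric])
  also have "fdet k (\<lambda>l. ballot l 0) = 1"
    using ballot_eq_1[of _ 0] by (subst fdet_lower) (auto intro: ballot_eq_0)
  finally have "\<bar>?D\<bar> = \<bar>fdet k (\<lambda>i j. catalan (n + i + j))\<bar> * \<bar>fdet k (\<lambda>t j. Q j $ t)\<bar>"
    using abs_fdet_reverse_columns[of k "\<lambda>i j. catalan (n + i + j)"] by (simp add: abs_mult)
  also have "\<bar>fdet k (\<lambda>t j. Q j $ t)\<bar> = (\<Prod>j<k. 2 * real (Suc j))"
    by (subst fdet_upper) (auto simp: Q abs_prod abs_mult)
  also have "\<dots> = 2 ^ k * fact k"
    by (simp only: prod.distrib fact_prod_Suc atLeast0LessThan prod_constant card_lessThan of_nat_prod)
  finally show ?thesis by simp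
qed

section \<open>Tilings as sequences of particle configurations\<close>

text \<open>A cell \<open>(r, p)\<close> lies in row \<open>r\<close>; going up one row moves half a cell to the left if \<open>p\<close> is kept and
  half a cell to the right if \<open>p\<close> increases by one. The left stones would be the tiles with \<open>d = 0\<close> and \<open>e = 1\<close>.\<close>

definition tile :: "nat \<Rightarrow> nat \<Rightarrow> nat \<Rightarrow> nat \<Rightarrow> (nat \<times> nat) set" where
  "tile r p d e = {(r, p), (r + 1, p + d), (r + 2, p + d + e)}"

definition tiles :: "(nat \<times> nat) set set" where
  "tiles = {tile r p d e | r p d e. e \<le> d \<and> d \<le> 1}"

definition cell_tilings :: "(nat \<times> nat) set \<Rightarrow> (nat \<times> nat) set set set" where
  "cell_tilings R = {P. partition_on R P \<and> P \<subseteq> tiles}"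

lemma tile_eq_iff: "tile r p d e = tile r' p' d' e' \<longleftrightarrow> r = r' \<and> p = p' \<and> d = d' \<and> e = e'"
proof
  assume *: "tile r p d e = tile r' p' d' e'"
  have "(r, p) \<in> tile r' p' d' e'" unfolding *[symmetric] by (simp add: tile_def)
  moreover have "(r', p') \<in> tile r p d e" unfolding * by (simp add: tile_def)
  ultimately have 1: "r = r' \<and> p = p'" by (auto simp: tile_def)
  have "(r + 1, p + d) \<in> tile r' p' d' e'" "(r + 2, p + d + e) \<in> tile r' p' d' e'"
    unfolding *[symmetric] by (simp_all add: tile_def)
  then show "r = r' \<and> p = p' \<and> d = d' \<and> e = e'" using 1 by (auto simp: tile_def)
qed simp

lemma tile_row_unique: "t \<in> tiles \<Longrightarrow> (r, p) \<in> t \<Longrightarrow> (r, p') \<in> t \<Longrightarrow> p = p'"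
  by (auto simp: tiles_def tile_def)

lemma finite_cell_tilings:
  assumes "finite R"
  shows "finite (cell_tilings R)"
proof (rule finite_subset)
  show "cell_tilings R \<subseteq> Pow (Pow R)"
    by (auto simp: cell_tilings_def partition_on_def)
  show "finite (Pow (Pow R))" using assms by simp
qed

section \<open>Splitting tilings by their lowest layer\<close>

lemma card_cell_tilings_extending:
  assumes S: "S \<subseteq> R" and L: "partition_on (R - S) L" "L \<subseteq> tiles"
  shows "card {P \<in> cell_tilings R. L \<subseteq> P} = card (cell_tilings S)"
proof (rule bij_betw_same_card[of "\<lambda>P. P - L"], rule bij_betw_byWitness[where f' = "\<lambda>P. P \<union> L"])
  show "\<forall>P\<in>{P \<in> cell_tilings R. L \<subseteq> P}. P - L \<union> L = P" by auto
  show "\<forall>P\<in>cell_tilings S. P \<union> L - L = P"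
  proof
    fix P assume "P \<in> cell_tilings S"
    then have P: "partition_on S P" by (simp add: cell_tilings_def)
    have "t \<notin> L" if "t \<in> P" for t
    proof
      assume "t \<in> L"
      then have "t \<subseteq> R - S" using L(1) by (auto simp: partition_on_def)
      moreover have "t \<subseteq> S" "t \<noteq> {}" using P that by (auto simp: partition_on_def)
      ultimately show False by auto
    qed
    then show "P \<union> L - L = P" by auto
  qed
  show "(\<lambda>P. P - L) ` {P \<in> cell_tilings R. L \<subseteq> P} \<subseteq> cell_tilings S"
  proof clarify
    fix P assume P: "P \<in> cell_tilings R" "L \<subseteq> P"
    then have part: "partition_on R P" and "P \<subseteq> tiles" by (auto simp: cell_tilings_def)
    have "\<Union> (P - L) = S"
    proof
      show "\<Union> (P - L) \<subseteq> S"
      proof clarify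
        fix r p t assume t: "(r, p) \<in> t" "t \<in> P" "t \<notin> L"
        show "(r, p) \<in> S"
        proof (rule ccontr)
          assume "(r, p) \<notin> S"
          moreover have "(r, p) \<in> R" using t part by (auto simp: partition_on_def)
          ultimately have "(r, p) \<in> \<Union> L" using L(1) by (simp add: partition_on_def)
          then obtain t' where "t' \<in> L" "(r, p) \<in> t'" by auto
          moreover have "t' \<in> P" using P(2) \<open>t' \<in> L\<close> by (rule subsetD)
          ultimately have "t \<inter> t' \<noteq> {}" "t \<noteq> t'" using t by auto
          then show False
            using disjointD[of P t t'] t(2) \<open>t' \<in> P\<close> part by (simp add: partition_on_def)
        qed
      qed
      show "S \<subseteq> \<Union> (P - L)"
      proof clarify
        fix r p assume rp: "(r, p) \<in> S"
        then have "(r, p) \<in> \<Union> P" using S part by (auto simp: partition_on_def)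
        then obtain t where t: "t \<in> P" "(r, p) \<in> t" by auto
        have "t \<notin> L" using L(1) t rp by (auto simp: partition_on_def)
        then show "(r, p) \<in> \<Union> (P - L)" using t by auto
      qed
    qed
    then show "P - L \<in> cell_tilings S"
      using part \<open>P \<subseteq> tiles\<close> by (auto simp: cell_tilings_def partition_on_def intro: pairwise_subset)
  qed
  show "(\<lambda>P. P \<union> L) ` cell_tilings S \<subseteq> {P \<in> cell_tilings R. L \<subseteq> P}"
  proof clarify
    fix P assume "P \<in> cell_tilings S"
    then have P: "partition_on S P" "P \<subseteq> tiles" by (auto simp: cell_tilings_def)
    have "partition_on (S \<union> (R - S)) (P \<union> L)"
    proof -
      have "disjoint (P \<union> L)"
        using P(1) L(1) by (intro disjoint_union) (auto simp: partition_on_def)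
      then show ?thesis using P(1) L(1) by (auto simp: partition_on_def)
    qed
    moreover have "S \<union> (R - S) = R" using S by auto
    ultimately show "P \<union> L \<in> cell_tilings R \<and> L \<subseteq> P \<union> L"
      using P(2) L(2) by (auto simp: cell_tilings_def)
  qed
qed

text \<open>In the applications \<open>g\<close> is the next particle configuration,
  \<open>L g\<close> the layer of tiles leading to it, and \<open>S g\<close> the region above this
  layer.\<close>

lemma card_cell_tilings_split:
  assumes "finite R" "finite I"
    and S: "\<And>g. g \<in> I \<Longrightarrow> S g \<subseteq> R"
    and L: "\<And>g. g \<in> I \<Longrightarrow> partition_on (R - S g) (L g)" "\<And>g. g \<in> I \<Longrightarrow> L g \<subseteq> tiles"
    and ex: "\<And>P. P \<in> cell_tilings R \<Longrightarrow> \<exists>g\<in>I. L g \<subseteq> P"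
    and unique: "\<And>P g g'. P \<in> cell_tilings R \<Longrightarrow> g \<in> I \<Longrightarrow> g' \<in> I \<Longrightarrow> L g \<subseteq> P \<Longrightarrow> L g' \<subseteq> P \<Longrightarrow> g = g'"
  shows "card (cell_tilings R) = (\<Sum>g\<in>I. card (cell_tilings (S g)))"
proof -
  have "cell_tilings R = (\<Union>g\<in>I. {P \<in> cell_tilings R. L g \<subseteq> P})" using ex by auto
  also have "card \<dots> = (\<Sum>g\<in>I. card {P \<in> cell_tilings R. L g \<subseteq> P})"
    using assms(1,2) finite_cell_tilings unique by (intro card_UN_disjoint) auto
  also have "\<dots> = (\<Sum>g\<in>I. card (cell_tilings (S g)))"
    by (intro sum.cong refl card_cell_tilings_extending S L)
  finally show ?thesis .
qed

lemma partition_onI_unique: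
  assumes "\<Union> L = A" "{} \<notin> L" "\<And>c t t'. t \<in> L \<Longrightarrow> t' \<in> L \<Longrightarrow> c \<in> t \<Longrightarrow> c \<in> t' \<Longrightarrow> t = t'"
  shows "partition_on A L"
  using assms unfolding partition_on_def disjoint_def by blast

locale cell_tiling =
  fixes R :: "(nat \<times> nat) set" and P
  assumes P: "P \<in> cell_tilings R"
begin

lemma tile_in: "tile r p d e \<in> P \<Longrightarrow> (r, p) \<in> R \<and> (r + 1, p + d) \<in> R \<and> (r + 2, p + d + e) \<in> R"
  using P by (auto simp: cell_tilings_def partition_on_def tile_def)

lemma tile_bounds: "tile r p d e \<in> P \<Longrightarrow> e \<le> d \<and> d \<le> 1"
  using P by (fastforce simp: cell_tilings_def tiles_def tile_eq_iff)

lemma same: "t \<in> P \<Longrightarrow> t' \<in> P \<Longrightarrow> c \<in> t \<Longrightarrow> c \<in> t' \<Longrightarrow> t = t'"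
  using P by (auto simp: cell_tilings_def partition_on_def disjoint_def)

lemma row_unique: "t \<in> P \<Longrightarrow> (r, p) \<in> t \<Longrightarrow> (r, p') \<in> t \<Longrightarrow> p = p'"
  using P tile_row_unique by (auto simp: cell_tilings_def)

lemma cover:
  assumes "(r, p) \<in> R"
  obtains (bottom) d e where "tile r p d e \<in> P"
  | (middle) r' p' d e where "r = Suc r'" "p = p' + d" "tile r' p' d e \<in> P"
  | (top) r' p' d e where "r = Suc (Suc r')" "p = p' + d + e" "tile r' p' d e \<in> P"
proof -
  obtain t where "t \<in> P" "(r, p) \<in> t" "t \<in> tiles"
    using assms P by (auto simp: cell_tilings_def partition_on_def)
  then show ?thesis using that by (fastforce simp: tiles_def tile_def)
qed

end


text \<open>The cells of the benzel with \<open>a = n + 3 * k\<close> and \<open>b = 2 * n + 3 * k - 1\<close>.\<close>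

definition region :: "nat \<Rightarrow> nat \<Rightarrow> (nat \<times> nat) set" where
  "region n k = {(r, p). r \<le> 3 * p + 1 \<and> 3 * p + 1 \<le> 3 * k + 2 * r \<and> 3 * p + 4 \<le> 3 * n + 6 * k + r \<and>
     2 * r + 2 \<le> 3 * p + 3 * n + 3 * k \<and> r + 3 \<le> 3 * n + 6 * k}"

text \<open>What remains after all tiles starting below row \<open>3 * i\<close> are placed.
  Positions are measured from \<open>i\<close>, which puts the left boundary at 0 in the lower
  half.\<close>

definition upper_region :: "nat \<Rightarrow> nat \<Rightarrow> nat \<Rightarrow> nat set \<Rightarrow> (nat \<times> nat) set" where
  "upper_region n k i A = {(3 * i, i + x) | x. x \<in> A} \<union> {(r, p) \<in> region n k. r > 3 * i}"

lemma finite_region: "finite (region n k)"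
proof (rule finite_subset)
  show "region n k \<subseteq> {..3 * n + 6 * k} \<times> {..3 * n + 6 * k + (3 * n + 6 * k)}"
    by (auto simp: region_def)
qed simp

lemma finite_upper_region: "finite A \<Longrightarrow> finite (upper_region n k i A)"
  by (auto simp: upper_region_def Setcompr_eq_image intro: finite_subset[OF _ finite_region[of n k]])

lemma upper_region_iff:
  "(r, p) \<in> upper_region n k i A \<longleftrightarrow>
     (r = 3 * i \<and> i \<le> p \<and> p - i \<in> A) \<or> (r > 3 * i \<and> (r, p) \<in> region n k)"
  by (auto simp: upper_region_def intro: exI[of _ "p - i"])

text \<open>The first two rows have equally many cells and ranges shifted by one; this is what
  forces the step between them.\<close>

lemma lower_rows:
  assumes "i + 2 \<le> n + k"
  shows "(Suc (3 * i), p) \<in> region n k \<longleftrightarrow> i \<le> p \<and> p \<le> k + 2 * i"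
    and "(Suc (Suc (3 * i)), p) \<in> region n k \<longleftrightarrow> i + 1 \<le> p \<and> p \<le> k + 2 * i + 1"
    and "(Suc (Suc (Suc (3 * i))), p) \<in> region n k \<longleftrightarrow> i + 1 \<le> p \<and> p \<le> k + 2 * i + 1"
  using assms by (auto simp: region_def)

text \<open>Now the first two rows have the same range, so the step between them keeps
  \<open>p\<close>. The third row lacks the left end, and this removes a particle.\<close>

lemma upper_rows:
  assumes "i + 1 = n + k + s" "s < k"
  shows "(Suc (3 * i), p) \<in> region n k \<longleftrightarrow> i + s + 1 \<le> p \<and> p + 1 \<le> i + n + 2 * k"
    and "(Suc (Suc (3 * i)), p) \<in> region n k \<longleftrightarrow> i + s + 1 \<le> p \<and> p + 1 \<le> i + n + 2 * k"
    and "(Suc (Suc (Suc (3 * i))), p) \<in> region n k \<longleftrightarrow> i + s + 2 \<le> p \<and> p + 1 \<le> i + n + 2 * k"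
  using assms by (auto simp: region_def)

text \<open>The tiles with lowest cell in row \<open>3 * i\<close> or \<open>3 * i + 1\<close>, for \<open>i + 2 \<le> n + k\<close>; no tile starts in row
  \<open>3 * i + 2\<close>. The set \<open>A\<close> gives the tiles starting in row \<open>3 * i\<close>, and \<open>H\<close> tells which of the other tiles
  are rising bones rather than right stones.\<close>

definition lower_layer :: "nat \<Rightarrow> nat \<Rightarrow> nat set \<Rightarrow> (nat \<Rightarrow> bool) \<Rightarrow> (nat \<times> nat) set set" where
  "lower_layer k i A H = {tile (3 * i) (i + x) 1 1 | x. x \<in> A} \<union>
     {tile (Suc (3 * i)) (i + b) 1 (of_bool (H b)) | b. b \<le> k + i \<and> b \<notin> Suc ` A}"

lemma lower_layer_subset_tiles: "lower_layer k i A H \<subseteq> tiles"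
  by (fastforce simp: lower_layer_def tiles_def)

lemma lower_layer_cong:
  assumes "\<And>b. b \<le> k + i \<Longrightarrow> b \<notin> Suc ` A \<Longrightarrow> H b = H' b"
  shows "lower_layer k i A H = lower_layer k i A H'"
  unfolding lower_layer_def using assms by (simp cong: rev_conj_cong)

text \<open>Once the middle step is forced, the only freedom is whether a tile starting in row
  \<open>3 * i + 1\<close> turns right at its last step. Neighbouring tiles must not collide there,
  and the last one must not leave the region.\<close>

lemma lower_layer_in_tiling:
  assumes i: "i + 2 \<le> n + k" and A: "A \<subseteq> {..<k + i}"
    and P: "P \<in> cell_tilings (upper_region n k i A)"
  shows "\<exists>H. lower_layer k i A H \<subseteq> P \<and>
    (\<forall>b. b < k + i \<longrightarrow> b \<notin> Suc ` A \<longrightarrow> Suc b \<notin> Suc ` A \<longrightarrow> H b \<longrightarrow> H (Suc b)) \<and>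
    (\<forall>b. b \<le> k + i \<longrightarrow> b \<notin> Suc ` A \<longrightarrow> H b \<longrightarrow> b < k + i)"
proof -
  interpret cell_tiling "upper_region n k i A" P using P by unfold_locales
  note rows = lower_rows[OF i] upper_region_iff
  have bottom_row: "3 * i \<le> r" if "tile r p d e \<in> P" for r p d e
    using tile_in[OF that] by (auto simp: upper_region_iff)
  \<comment> \<open>The left end has to move right, since row \<open>3 * i + 2\<close> lacks its
    position. Any other cell that kept its position would take the cell already entered from
    \<open>p - 1\<close>.\<close>
  have middle_step: "(Suc (Suc (3 * i)), Suc p) \<in> t"
    if "i \<le> p" "p \<le> k + 2 * i" "t \<in> P" "(Suc (3 * i), p) \<in> t" for p t
    using that
  proof (induction p arbitrary: t rule: less_induct)
    case (less p)
    have "(Suc (3 * i), p) \<in> upper_region n k i A" using less.prems by (simp add: rows)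
    then obtain t' \<delta> where t': "t' \<in> P" "(Suc (3 * i), p) \<in> t'" "\<delta> \<le> 1" "(Suc (Suc (3 * i)), p + \<delta>) \<in> t'"
    proof (cases rule: cover)
      case (bottom d e)
      then show ?thesis using that[of "tile (Suc (3 * i)) p d e" d] tile_bounds[OF bottom]
        by (simp add: tile_def)
    next
      case (middle r' p' d e)
      then show ?thesis using that[of "tile r' p' d e" e] tile_bounds[OF middle(3)]
        by (simp add: tile_def)
    next
      case (top r' p' d e)
      then show ?thesis using bottom_row[OF top(3)] by simp
    qed
    have "t' = t" using same t' less.prems by blast
    have "\<delta> = 1"
    proof (rule ccontr)
      assume "\<delta> \<noteq> 1"
      then have top: "(Suc (Suc (3 * i)), p) \<in> t'" using t' by (cases \<delta>) auto
      then have "(Suc (Suc (3 * i)), p) \<in> upper_region n k i A"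
        using t'(1) P by (auto simp: cell_tilings_def partition_on_def)
      then have p: "i + 1 \<le> p" by (simp add: rows)
      then have "(Suc (3 * i), p - 1) \<in> upper_region n k i A" using less.prems by (auto simp: rows)
      then obtain t'' where t'': "t'' \<in> P" "(Suc (3 * i), p - 1) \<in> t''"
        using P by (auto simp: cell_tilings_def partition_on_def)
      then have "(Suc (Suc (3 * i)), Suc (p - 1)) \<in> t''"
        using less.IH[of "p - 1" t''] p less.prems by simp
      then have "t'' = t'" using same[OF t''(1) t'(1)] top p by simp
      then show False using row_unique[OF t'(1) t'(2), of "p - 1"] t'' p by simp
    qed
    then show ?case using t' \<open>t' = t\<close> by simp
  qed
  \<comment> \<open>The middle step is the second step of such a tile, so \<open>e = 1\<close>; as
    left stones are excluded, \<open>e \<le> d\<close> gives \<open>d = 1\<close>.\<close>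
  have bone: "d = 1 \<and> e = 1" if "tile (3 * i) p d e \<in> P" for p d e
  proof -
    have "(Suc (3 * i), p + d) \<in> upper_region n k i A" using tile_in[OF that] by simp
    then have "(Suc (Suc (3 * i)), Suc (p + d)) \<in> tile (3 * i) p d e"
      using middle_step[of "p + d", OF _ _ that] by (simp add: rows tile_def)
    then show ?thesis using tile_bounds[OF that] by (auto simp: tile_def)
  qed
  have bones: "tile (3 * i) (i + x) 1 1 \<in> P" if "x \<in> A" for x
  proof -
    have "(3 * i, i + x) \<in> upper_region n k i A" using that by (simp add: rows)
    then show ?thesis
    proof (cases rule: cover)
      case (bottom d e)
      then show ?thesis using bone[OF bottom] by simp
    next
      case (middle r' p' d e)
      then show ?thesis using bottom_row[OF middle(3)] by simp
    next
      case (top r' p' d e)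
      then show ?thesis using bottom_row[OF top(3)] by simp
    qed
  qed
  define H where "H b \<longleftrightarrow> tile (Suc (3 * i)) (i + b) 1 1 \<in> P" for b
  have free: "tile (Suc (3 * i)) (i + b) 1 (of_bool (H b)) \<in> P" if "b \<le> k + i" "b \<notin> Suc ` A" for b
  proof -
    have "(Suc (3 * i), i + b) \<in> upper_region n k i A" using that by (simp add: rows)
    then show ?thesis
    proof (cases rule: cover)
      case (bottom d e)
      have "(Suc (Suc (3 * i)), Suc (i + b)) \<in> tile (Suc (3 * i)) (i + b) d e"
        using middle_step[of "i + b", OF _ _ bottom] that by (simp add: tile_def)
      then have "d = 1" by (auto simp: tile_def)
      moreover have "e = 0 \<or> e = 1" using tile_bounds[OF bottom] by auto
      ultimately show ?thesis using bottom by (cases "H b") (auto simp: H_def)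
    next
      case (middle r' p' d e)
      then have m: "tile (3 * i) p' d e \<in> P" by simp
      have "d = 1" "p' - i \<in> A" "i \<le> p'" using bone[OF m] tile_in[OF m] by (auto simp: rows)
      then have "b = Suc (p' - i)" using middle(2) by simp
      then show ?thesis using that \<open>p' - i \<in> A\<close> by blast
    next
      case (top r' p' d e)
      then show ?thesis using bottom_row[OF top(3)] by simp
    qed
  qed
  have "lower_layer k i A H \<subseteq> P"
    using bones free unfolding lower_layer_def by blast
  moreover have "H (Suc b)" if "b < k + i" "b \<notin> Suc ` A" "Suc b \<notin> Suc ` A" "H b" for b
  proof (rule ccontr)
    assume "\<not> H (Suc b)"
    then have "tile (Suc (3 * i)) (i + Suc b) 1 0 \<in> P" using free[of "Suc b"] that by simp
    moreover have "tile (Suc (3 * i)) (i + b) 1 1 \<in> P" using that by (simp add: H_def)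
    ultimately have "tile (Suc (3 * i)) (i + Suc b) 1 0 = tile (Suc (3 * i)) (i + b) 1 1"
      by (rule same[where c = "(Suc (Suc (Suc (3 * i))), i + b + 2)"]) (simp_all add: tile_def)
    then show False by (simp add: tile_eq_iff)
  qed
  moreover have "b < k + i" if "b \<le> k + i" "b \<notin> Suc ` A" "H b" for b
  proof -
    have "tile (Suc (3 * i)) (i + b) 1 1 \<in> P" using that by (simp add: H_def)
    from tile_in[OF this] show ?thesis by (simp add: rows)
  qed
  ultimately show ?thesis by blast
qed


text \<open>The hypotheses express that the tops \<open>b + of_bool (H b)\<close> of the free tiles
  are exactly the positions outside \<open>G\<close>. They are met by \<open>H = hops k a g\<close>
  and \<open>G\<close> the image of \<open>g\<close>.\<close>

lemma lower_layer_partition: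
  assumes i: "i + 2 \<le> n + k" and A: "A \<subseteq> {..<k + i}" and G: "G \<subseteq> {..k + i}"
    and H_bound: "\<And>b. H b \<Longrightarrow> b < k + i"
    and H1: "\<And>b. b \<notin> Suc ` A \<Longrightarrow> H b \<Longrightarrow> Suc b \<notin> G"
    and H0: "\<And>b. b \<notin> Suc ` A \<Longrightarrow> \<not> H b \<Longrightarrow> b \<notin> G"
    and mono: "\<And>b. b \<notin> Suc ` A \<Longrightarrow> Suc b \<notin> Suc ` A \<Longrightarrow> H b \<Longrightarrow> H (Suc b)"
    and hit: "\<And>x. x \<notin> G \<Longrightarrow> (x \<notin> Suc ` A \<and> \<not> H x) \<or> (\<exists>b. x = Suc b \<and> b \<notin> Suc ` A \<and> H b)"
  shows "partition_on (upper_region n k i A - upper_region n k (Suc i) G) (lower_layer k i A H)"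
proof (rule partition_onI_unique)
  let ?D = "upper_region n k i A - upper_region n k (Suc i) G"
  note rows = lower_rows[OF i] upper_region_iff
  have D: "(r, p) \<in> ?D \<longleftrightarrow> (r = 3 * i \<and> i \<le> p \<and> p - i \<in> A) \<or>
      (r = Suc (3 * i) \<and> i \<le> p \<and> p \<le> k + 2 * i) \<or>
      (r = Suc (Suc (3 * i)) \<and> i + 1 \<le> p \<and> p \<le> k + 2 * i + 1) \<or>
      (r = Suc (Suc (Suc (3 * i))) \<and> i + 1 \<le> p \<and> p \<le> k + 2 * i + 1 \<and> p - Suc i \<notin> G)" for r p
  proof -
    consider "r \<le> 3 * i" | "r = Suc (3 * i)" | "r = Suc (Suc (3 * i))"
      | "r = Suc (Suc (Suc (3 * i)))" | "r > Suc (Suc (Suc (3 * i)))" by linarith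
    then show ?thesis by cases (auto simp: rows)
  qed
  show "\<Union> (lower_layer k i A H) = ?D"
  proof (rule Set.set_eqI)
    fix c :: "nat \<times> nat"
    obtain r p where c: "c = (r, p)" by (cases c)
    show "c \<in> \<Union> (lower_layer k i A H) \<longleftrightarrow> c \<in> ?D"
      unfolding c
    proof
      assume "(r, p) \<in> \<Union> (lower_layer k i A H)"
      then consider x where "x \<in> A" "(r, p) \<in> tile (3 * i) (i + x) 1 1"
        | b where "b \<le> k + i" "b \<notin> Suc ` A" "(r, p) \<in> tile (Suc (3 * i)) (i + b) 1 (of_bool (H b))"
        unfolding lower_layer_def by blast
      then show "(r, p) \<in> ?D"
      proof cases
        case 1
        then have "x < k + i" using A by auto
        then show ?thesis using 1 unfolding D by (auto simp: tile_def)
      next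
        case 2
        define e :: nat where "e = of_bool (H b)"
        have "(r = Suc (3 * i) \<and> p = i + b) \<or> (r = Suc (Suc (3 * i)) \<and> p = i + b + 1) \<or>
            (r = Suc (Suc (Suc (3 * i))) \<and> p = Suc i + (b + e))"
          using 2(3) by (auto simp: tile_def e_def)
        moreover have "b + e \<le> k + i \<and> b + e \<notin> G"
          using 2 H_bound[of b] H1[of b] H0[of b] by (cases "H b") (simp_all add: e_def)
        ultimately show ?thesis using 2(1) unfolding D by (elim disjE conjE) simp_all
      qed
    next
      assume "(r, p) \<in> ?D"
      then consider "r = 3 * i" "i \<le> p" "p - i \<in> A" | "r = Suc (3 * i)" "i \<le> p" "p \<le> k + 2 * i"
        | "r = Suc (Suc (3 * i))" "i + 1 \<le> p" "p \<le> k + 2 * i + 1"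
        | "r = Suc (Suc (Suc (3 * i)))" "i + 1 \<le> p" "p \<le> k + 2 * i + 1" "p - Suc i \<notin> G"
        unfolding D by blast
      then show "(r, p) \<in> \<Union> (lower_layer k i A H)"
      proof cases
        case 1
        then have "tile (3 * i) (i + (p - i)) 1 1 \<in> lower_layer k i A H"
          unfolding lower_layer_def by blast
        moreover have "(r, p) \<in> tile (3 * i) (i + (p - i)) 1 1" using 1 by (simp add: tile_def)
        ultimately show ?thesis by blast
      next
        case 2
        show ?thesis
        proof (cases "p - i \<in> Suc ` A")
          case True
          then obtain x where x: "x \<in> A" "p - i = Suc x" by auto
          then have "tile (3 * i) (i + x) 1 1 \<in> lower_layer k i A H"
            unfolding lower_layer_def by blast
          moreover have "(r, p) \<in> tile (3 * i) (i + x) 1 1" using x 2 by (simp add: tile_def)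
          ultimately show ?thesis by blast
        next
          case False
          then have "tile (Suc (3 * i)) (i + (p - i)) 1 (of_bool (H (p - i))) \<in> lower_layer k i A H"
            using 2 unfolding lower_layer_def by fastforce
          moreover have "(r, p) \<in> tile (Suc (3 * i)) (i + (p - i)) 1 (of_bool (H (p - i)))"
            using 2 by (simp add: tile_def)
          ultimately show ?thesis by blast
        qed
      next
        case 3
        show ?thesis
        proof (cases "p - Suc i \<in> Suc ` A")
          case True
          then obtain x where x: "x \<in> A" "p - Suc i = Suc x" by auto
          then have "tile (3 * i) (i + x) 1 1 \<in> lower_layer k i A H"
            unfolding lower_layer_def by blast
          moreover have "(r, p) \<in> tile (3 * i) (i + x) 1 1" using x 3 by (simp add: tile_def)
          ultimately show ?thesis by blast
        next
          case False
          then have "tile (Suc (3 * i)) (i + (p - Suc i)) 1 (of_bool (H (p - Suc i))) \<in> lower_layer k i A H"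
            using 3 unfolding lower_layer_def by fastforce
          moreover have "(r, p) \<in> tile (Suc (3 * i)) (i + (p - Suc i)) 1 (of_bool (H (p - Suc i)))"
            using 3 by (simp add: tile_def)
          ultimately show ?thesis by blast
        qed
      next
        case 4
        have "\<exists>b. b \<notin> Suc ` A \<and> p - Suc i = b + of_bool (H b)"
          using hit[OF 4(4)]
        proof (elim disjE exE conjE)
          fix b assume "p - Suc i = Suc b" "b \<notin> Suc ` A" "H b"
          then show ?thesis by (intro exI[of _ b]) simp
        qed (intro exI[of _ "p - Suc i"], simp)
        then obtain b where b: "b \<notin> Suc ` A" "p - Suc i = b + of_bool (H b)" by blast
        then have "tile (Suc (3 * i)) (i + b) 1 (of_bool (H b)) \<in> lower_layer k i A H"
          using 4 unfolding lower_layer_def by fastforce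
        moreover have "(r, p) \<in> tile (Suc (3 * i)) (i + b) 1 (of_bool (H b))"
          using b 4 by (simp add: tile_def)
        ultimately show ?thesis by blast
      qed
    qed
  qed
  show "{} \<notin> lower_layer k i A H" by (auto simp: lower_layer_def tile_def)
  \<comment> \<open>Two tops can coincide only for neighbours with \<open>H b\<close> and not
    \<open>H (Suc b)\<close>, which \<open>mono\<close> excludes.\<close>
  have inj: "b = b'" if "b \<notin> Suc ` A" "b' \<notin> Suc ` A" "b + of_bool (H b) = b' + of_bool (H b')" for b b'
    using that mono[of b] mono[of b'] by (cases "H b"; cases "H b'") auto
  show "t = t'" if "t \<in> lower_layer k i A H" "t' \<in> lower_layer k i A H" "c \<in> t" "c \<in> t'" for c t t'
  proof -
    have cases_layer: "(\<exists>x\<in>A. u = tile (3 * i) (i + x) 1 1) \<or>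
        (\<exists>b. b \<notin> Suc ` A \<and> u = tile (Suc (3 * i)) (i + b) 1 (of_bool (H b)))"
      if "u \<in> lower_layer k i A H" for u
      using that unfolding lower_layer_def by blast
    have tt: "\<And>x x'. t = tile (3 * i) (i + x) 1 1 \<Longrightarrow> t' = tile (3 * i) (i + x') 1 1 \<Longrightarrow> t = t'"
      using that by (auto simp: tile_def)
    have mixed: False if "x \<in> A" "b \<notin> Suc ` A" "c \<in> tile (3 * i) (i + x) 1 1"
      "c \<in> tile (Suc (3 * i)) (i + b) 1 (of_bool (H b))" for x b
      using that by (auto simp: tile_def)
    have bb: "t = t'" if "b \<notin> Suc ` A" "b' \<notin> Suc ` A"
      "t = tile (Suc (3 * i)) (i + b) 1 (of_bool (H b))"
      "t' = tile (Suc (3 * i)) (i + b') 1 (of_bool (H b'))" for b b'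
    proof -
      have "b = b' \<or> b + of_bool (H b) = b' + of_bool (H b')"
        using \<open>c \<in> t\<close> \<open>c \<in> t'\<close> that(3,4) by (auto simp: tile_def)
      then have "b = b'" using inj[OF that(1,2)] by (elim disjE) simp_all
      then show ?thesis using that(3,4) by simp
    qed
    show ?thesis
      using cases_layer[OF that(1)] cases_layer[OF that(2)]
    proof (elim disjE bexE exE conjE)
      fix x b assume "x \<in> A" "t = tile (3 * i) (i + x) 1 1" "b \<notin> Suc ` A"
        "t' = tile (Suc (3 * i)) (i + b) 1 (of_bool (H b))"
      then show ?thesis using mixed[of x b] that(3,4) by simp
    next
      fix x b assume "x \<in> A" "t' = tile (3 * i) (i + x) 1 1" "b \<notin> Suc ` A"
        "t = tile (Suc (3 * i)) (i + b) 1 (of_bool (H b))"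
      then show ?thesis using mixed[of x b] that(3,4) by simp
    qed (erule (1) tt, erule (3) bb)
  qed
qed


section \<open>Interlacing configurations\<close>

definition gap_start :: "(nat \<Rightarrow> nat) \<Rightarrow> nat \<Rightarrow> nat" where
  "gap_start a l = (if l = 0 then 0 else a (l - 1) + 2)"

text \<open>The bone of the particle \<open>a l\<close> fills position \<open>a l + 1\<close> of the
  next row, a hole for the free tiles. Each gap between holes, together with the hole at its right
  end, receives exactly one new particle.\<close>

definition interlacing :: "nat \<Rightarrow> (nat \<Rightarrow> nat) \<Rightarrow> (nat \<Rightarrow> nat) set" where
  "interlacing k a = PiE {..<k} (\<lambda>l. {gap_start a l..Suc (a l)})"

text \<open>Marks the rising bones among the free tiles: those from the new particle up to the hole
  shift right, which vacates \<open>g l\<close> and covers the position of the hole.\<close>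

definition hops :: "nat \<Rightarrow> (nat \<Rightarrow> nat) \<Rightarrow> (nat \<Rightarrow> nat) \<Rightarrow> nat \<Rightarrow> bool" where
  "hops k a g b \<longleftrightarrow> (\<exists>l<k. g l \<le> b \<and> b \<le> a l)"

context
  fixes k m :: nat and a :: "nat \<Rightarrow> nat"
  assumes a_mono: "strict_mono_on {..<k} a" and bounded: "\<forall>l<k. a l < m"
begin

lemma a_bound: "l < k \<Longrightarrow> a l < m"
  using bounded by simp

lemma a_less_iff: "l < k \<Longrightarrow> l' < k \<Longrightarrow> a l < a l' \<longleftrightarrow> l < l'"
  using a_mono strict_mono_on_less[of "{..<k}" a l l'] by simp

lemma gap_start_le: "l < k \<Longrightarrow> gap_start a l \<le> Suc (a l)"
  using a_less_iff[of "l - 1" l] by (cases l) (auto simp: gap_start_def)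

lemma gap_start_greater:
  assumes "l' < l" "l < k"
  shows "Suc (a l') < gap_start a l"
proof -
  have "a l' \<le> a (l - 1)"
    using assms a_less_iff[of l' "l - 1"] by (cases "l' = l - 1") (auto intro: less_imp_le)
  then show ?thesis using assms by (simp add: gap_start_def)
qed

lemma gap_unique:
  assumes "l < k" "l' < k" "gap_start a l \<le> x" "x \<le> Suc (a l)" "gap_start a l' \<le> x" "x \<le> Suc (a l')"
  shows "l = l'"
proof (rule ccontr)
  assume "l \<noteq> l'"
  then consider "l < l'" | "l' < l" by linarith
  then show False
    using gap_start_greater[of l l'] gap_start_greater[of l' l] assms by cases simp_all
qed

lemma gap_not_hole:
  assumes "l < k" "gap_start a l \<le> x" "x \<le> a l"
  shows "x \<notin> Suc ` a ` {..<k}"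
proof
  assume "x \<in> Suc ` a ` {..<k}"
  then obtain l' where l': "l' < k" "x = Suc (a l')" by auto
  then have "l' = l"
    using gap_unique[of l' l x] gap_start_le[of l'] assms by simp
  then show False using l' assms by simp
qed

lemma interlacing_bounds:
  "g \<in> interlacing k a \<Longrightarrow> l < k \<Longrightarrow> gap_start a l \<le> g l \<and> g l \<le> Suc (a l)"
  using PiE_mem[of g "{..<k}" "\<lambda>l. {gap_start a l..Suc (a l)}" l] by (simp add: interlacing_def)

lemma interlacing_mono: "g \<in> interlacing k a \<Longrightarrow> strict_mono_on {..<k} g"
proof (rule strict_mono_onI)
  fix l' l assume "g \<in> interlacing k a" "l' \<in> {..<k}" "l \<in> {..<k}" "l' < l"
  then show "g l' < g l"
    using interlacing_bounds[of g l'] interlacing_bounds[of g l] gap_start_greater[of l' l] by simp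
qed

lemma interlacing_bound: "g \<in> interlacing k a \<Longrightarrow> l < k \<Longrightarrow> g l < Suc m"
  using interlacing_bounds[of g l] a_bound[of l] by simp

lemma hops_bound: "hops k a g b \<Longrightarrow> b < m"
  using a_bound by (force simp: hops_def)

lemma hops_Suc_notin:
  assumes g: "g \<in> interlacing k a" and b: "hops k a g b"
  shows "Suc b \<notin> g ` {..<k}"
proof
  assume "Suc b \<in> g ` {..<k}"
  then obtain l where l: "l < k" "Suc b = g l" by auto
  obtain l' where l': "l' < k" "g l' \<le> b" "b \<le> a l'" using b by (auto simp: hops_def)
  have "l = l'"
    using gap_unique[of l l' "Suc b"] interlacing_bounds[OF g, of l] interlacing_bounds[OF g, of l'] l l'
    by simp
  then show False using l l' by simp
qed

lemma not_hops_notin: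
  assumes g: "g \<in> interlacing k a" and b: "b \<notin> Suc ` a ` {..<k}" "\<not> hops k a g b"
  shows "b \<notin> g ` {..<k}"
proof
  assume "b \<in> g ` {..<k}"
  then obtain l where l: "l < k" "b = g l" by auto
  then have "b \<noteq> Suc (a l)" using b(1) by blast
  then have "b \<le> a l" using interlacing_bounds[OF g, of l] l by simp
  then show False using b(2) l by (auto simp: hops_def)
qed

lemma hops_Suc:
  assumes "Suc b \<notin> Suc ` a ` {..<k}" "hops k a g b"
  shows "hops k a g (Suc b)"
proof -
  obtain l where l: "l < k" "g l \<le> b" "b \<le> a l" using assms by (auto simp: hops_def)
  moreover have "b \<noteq> a l" using assms(1) l by blast
  ultimately show ?thesis by (auto simp: hops_def intro!: exI[of _ l])
qed

text \<open>This supplies \<open>hit\<close>: right of the new particle of its gap, a position is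
  reached from its left neighbour; otherwise it is reached from straight below.\<close>

lemma notin_interlacing_cases:
  assumes g: "g \<in> interlacing k a" and x: "x \<notin> g ` {..<k}"
  shows "(x \<notin> Suc ` a ` {..<k} \<and> \<not> hops k a g x) \<or>
    (\<exists>b. x = Suc b \<and> b \<notin> Suc ` a ` {..<k} \<and> hops k a g b)"
proof (cases "\<exists>l<k. g l < x \<and> x \<le> Suc (a l)")
  case True
  then obtain l where l: "l < k" "g l < x" "x \<le> Suc (a l)" by blast
  then obtain b where b: "x = Suc b" by (cases x) auto
  have "b \<notin> Suc ` a ` {..<k}"
    using gap_not_hole[of l b] l b interlacing_bounds[OF g, of l] by simp
  moreover have "hops k a g b" using l b by (auto simp: hops_def intro!: exI[of _ l])
  ultimately show ?thesis using b by blast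
next
  case False
  have "\<not> hops k a g x"
  proof
    assume "hops k a g x"
    then obtain l where "l < k" "g l \<le> x" "x \<le> a l" by (auto simp: hops_def)
    moreover have "g l \<noteq> x" using x \<open>l < k\<close> by blast
    ultimately have "l < k \<and> g l < x \<and> x \<le> Suc (a l)" by simp
    then show False using False by blast
  qed
  moreover have "x \<notin> Suc ` a ` {..<k}"
  proof
    assume "x \<in> Suc ` a ` {..<k}"
    then obtain l where l: "l < k" "x = Suc (a l)" by auto
    then have "g l \<noteq> x" using x by blast
    then have "l < k \<and> g l < x \<and> x \<le> Suc (a l)" using l interlacing_bounds[OF g, of l] by simp
    then show False using False by blast
  qed
  ultimately show ?thesis by blast
qed

text \<open>If \<open>g l < g' l\<close>, then \<open>g l\<close> hops under \<open>g\<close> but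
  not under \<open>g'\<close>; hence a layer determines its configuration.\<close>

lemma interlacing_eqI:
  assumes g: "g \<in> interlacing k a" "g' \<in> interlacing k a"
    and eq: "\<And>b. b \<le> m \<Longrightarrow> b \<notin> Suc ` a ` {..<k} \<Longrightarrow> hops k a g b = hops k a g' b"
  shows "g = g'"
proof -
  have less: "g' l \<le> g l" if l: "l < k" and g: "g \<in> interlacing k a" "g' \<in> interlacing k a"
    and eq: "\<And>b. b \<le> m \<Longrightarrow> b \<notin> Suc ` a ` {..<k} \<Longrightarrow> hops k a g b = hops k a g' b" for l g g'
  proof (rule ccontr)
    assume "\<not> g' l \<le> g l"
    then have gl: "g l < g' l" "g l \<le> a l"
      using interlacing_bounds[OF g(2) l] by auto
    then have "hops k a g (g l)" using l by (auto simp: hops_def)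
    moreover have "g l \<notin> Suc ` a ` {..<k}"
      using gap_not_hole[of l "g l"] interlacing_bounds[OF g(1) l] gl l by simp
    ultimately have "hops k a g' (g l)" using eq[of "g l"] a_bound[OF l] gl by simp
    then obtain l' where l': "l' < k" "g' l' \<le> g l" "g l \<le> a l'" by (auto simp: hops_def)
    then have "l = l'"
      using gap_unique[of l l' "g l"] interlacing_bounds[OF g(1) l] interlacing_bounds[OF g(2) l'(1)] l
      by simp
    then show False using l' gl by simp
  qed
  show ?thesis
  proof (rule PiE_ext[OF g[unfolded interlacing_def]])
    fix l assume "l \<in> {..<k}"
    then show "g l = g' l" using less[of l g g'] less[of l g' g] g eq by (simp add: antisym)
  qed
qed

text \<open>Inside a gap \<open>H\<close> is upward closed, so its first true position describes it.
  Beyond the last hole \<open>H\<close> would spread up to \<open>m\<close>, against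
  \<open>bound\<close>.\<close>

lemma interlacing_exists:
  assumes mono: "\<And>b. b < m \<Longrightarrow> b \<notin> Suc ` a ` {..<k} \<Longrightarrow> Suc b \<notin> Suc ` a ` {..<k} \<Longrightarrow> H b \<Longrightarrow> H (Suc b)"
    and bound: "\<And>b. b \<le> m \<Longrightarrow> b \<notin> Suc ` a ` {..<k} \<Longrightarrow> H b \<Longrightarrow> b < m"
  shows "\<exists>g\<in>interlacing k a. \<forall>b\<le>m. b \<notin> Suc ` a ` {..<k} \<longrightarrow> hops k a g b = H b"
proof -
  have up: "H c" if "b \<le> c" "c \<le> m" "H b" "\<And>x. b \<le> x \<Longrightarrow> x \<le> c \<Longrightarrow> x \<notin> Suc ` a ` {..<k}" for b c
    using that
  proof (induction c rule: dec_induct)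
    case (step c)
    then show ?case using mono[of c] by simp
  qed simp
  \<comment> \<open>The alternative \<open>x = Suc (a l)\<close> handles a gap in which
    \<open>H\<close> never holds: the new particle then sits at the hole.\<close>
  define g where "g = (\<lambda>l\<in>{..<k}. LEAST x. gap_start a l \<le> x \<and> (x = Suc (a l) \<or> H x))"
  have gl: "gap_start a l \<le> g l \<and> (g l = Suc (a l) \<or> H (g l))" if "l < k" for l
    using LeastI[of "\<lambda>x. gap_start a l \<le> x \<and> (x = Suc (a l) \<or> H x)" "Suc (a l)"]
      gap_start_le[OF that] that by (simp add: g_def)
  have gl_le: "g l \<le> x" if "l < k" "gap_start a l \<le> x" "x = Suc (a l) \<or> H x" for l x
    using Least_le[of "\<lambda>x. gap_start a l \<le> x \<and> (x = Suc (a l) \<or> H x)" x] that by (simp add: g_def)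
  have "g \<in> interlacing k a"
    unfolding interlacing_def
  proof (rule PiE_I)
    fix l assume "l \<in> {..<k}"
    then show "g l \<in> {gap_start a l..Suc (a l)}" using gl[of l] gl_le[of l "Suc (a l)"] gap_start_le[of l] by simp
  qed (simp add: g_def)
  moreover have "hops k a g b = H b" if b: "b \<le> m" "b \<notin> Suc ` a ` {..<k}" for b
  proof
    assume "hops k a g b"
    then obtain l where l: "l < k" "g l \<le> b" "b \<le> a l" by (auto simp: hops_def)
    then have "H (g l)" using gl[of l] by auto
    then show "H b"
      using up[of "g l" b] l b gap_not_hole[of l] gl[of l] by (meson le_trans)
  next
    assume H: "H b"
    have "\<exists>l<k. b \<le> a l"
    proof (rule ccontr)
      assume none: "\<not> (\<exists>l<k. b \<le> a l)"
      have "x \<notin> Suc ` a ` {..<k}" if "b \<le> x" for x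
      proof
        assume "x \<in> Suc ` a ` {..<k}"
        then obtain l where "l < k" "x = Suc (a l)" by auto
        moreover have "a l < b" using none \<open>l < k\<close> by auto
        ultimately have "b = Suc (a l)" using that by simp
        then show False using b(2) \<open>l < k\<close> by blast
      qed
      then show False using up[of b m] bound[of m] b H by simp
    qed
    then obtain l where l: "l < k" "b \<le> a l" and least: "\<And>l'. l' < l \<Longrightarrow> \<not> (l' < k \<and> b \<le> a l')"
      using exists_least_iff[of "\<lambda>l. l < k \<and> b \<le> a l"] by blast
    have "gap_start a l \<le> b"
    proof (cases l)
      case (Suc l')
      then have "a l' < b" using least[of l'] l by auto
      moreover have "b \<noteq> Suc (a l')" using b(2) l Suc by auto
      ultimately show ?thesis by (simp add: gap_start_def Suc)
    qed (simp add: gap_start_def)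
    then show "hops k a g b" using gl_le[of l b] l H by (auto simp: hops_def)
  qed
  ultimately show ?thesis by blast
qed

end

lemma card_cell_tilings_lower:
  assumes i: "i + 2 \<le> n + k" and a: "strict_mono_on {..<k} a" "\<forall>l<k. a l < k + i"
  shows "card (cell_tilings (upper_region n k i (a ` {..<k}))) =
    (\<Sum>g\<in>interlacing k a. card (cell_tilings (upper_region n k (Suc i) (g ` {..<k}))))"
proof (rule card_cell_tilings_split)
  let ?A = "a ` {..<k}"
  let ?L = "\<lambda>g. lower_layer k i ?A (hops k a g)"
  show "finite (upper_region n k i ?A)" by (rule finite_upper_region) simp
  show "finite (interlacing k a)" unfolding interlacing_def by (rule finite_PiE) auto
  show "upper_region n k (Suc i) (g ` {..<k}) \<subseteq> upper_region n k i ?A"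
    if "g \<in> interlacing k a" for g
  proof
    fix c assume c: "c \<in> upper_region n k (Suc i) (g ` {..<k})"
    obtain r p where rp: "c = (r, p)" by (cases c)
    have "(r, p) \<in> region n k" if row: "r = 3 * Suc i" "Suc i \<le> p" "p - Suc i \<in> g ` {..<k}"
    proof -
      obtain l where "l < k" "p = Suc i + g l" using row by auto
      moreover have "g l < Suc (k + i)"
        using interlacing_bound[OF a, of g l] \<open>g \<in> interlacing k a\<close> \<open>l < k\<close> by simp
      moreover have r: "r = Suc (Suc (Suc (3 * i)))" using row(1) by simp
      ultimately show ?thesis using lower_rows(3)[OF i, of p] unfolding r by simp
    qed
    then show "c \<in> upper_region n k i ?A" using c unfolding rp upper_region_iff by auto
  qed
  show "partition_on (upper_region n k i ?A - upper_region n k (Suc i) (g ` {..<k})) (?L g)"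
    if g: "g \<in> interlacing k a" for g
  proof (rule lower_layer_partition[OF i])
    show "?A \<subseteq> {..<k + i}" using a(2) by auto
    show "g ` {..<k} \<subseteq> {..k + i}" using interlacing_bound[OF a g] by force
  qed (erule hops_bound[OF a], erule hops_Suc_notin[OF a g],
      erule (1) not_hops_notin[OF a g], erule (1) hops_Suc[OF a],
      erule notin_interlacing_cases[OF a g])
  show "?L g \<subseteq> tiles" for g by (rule lower_layer_subset_tiles)
  show "\<exists>g\<in>interlacing k a. ?L g \<subseteq> P" if P: "P \<in> cell_tilings (upper_region n k i ?A)" for P
  proof -
    have "?A \<subseteq> {..<k + i}" using a(2) by auto
    from lower_layer_in_tiling[OF i this P] obtain H where H: "lower_layer k i ?A H \<subseteq> P"
      "\<And>b. b < k + i \<Longrightarrow> b \<notin> Suc ` ?A \<Longrightarrow> Suc b \<notin> Suc ` ?A \<Longrightarrow> H b \<Longrightarrow> H (Suc b)"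
      "\<And>b. b \<le> k + i \<Longrightarrow> b \<notin> Suc ` ?A \<Longrightarrow> H b \<Longrightarrow> b < k + i"
      by blast
    obtain g where g: "g \<in> interlacing k a" "\<And>b. b \<le> k + i \<Longrightarrow> b \<notin> Suc ` ?A \<Longrightarrow> hops k a g b = H b"
      using interlacing_exists[OF a, of H] H(2,3) by blast
    have "?L g = lower_layer k i ?A H"
      by (rule lower_layer_cong) (rule g(2))
    then show ?thesis using g H by auto
  qed
  show "g = g'" if P: "P \<in> cell_tilings (upper_region n k i ?A)" and g: "g \<in> interlacing k a" "g' \<in> interlacing k a"
    and L: "?L g \<subseteq> P" "?L g' \<subseteq> P" for P g g'
  proof (rule interlacing_eqI[OF a g])
    fix b assume b: "b \<le> k + i" "b \<notin> Suc ` ?A"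
    have in_P: "tile (Suc (3 * i)) (i + b) 1 (of_bool (hops k a h b)) \<in> P" if "?L h \<subseteq> P" for h
      using that b unfolding lower_layer_def by blast
    have "tile (Suc (3 * i)) (i + b) 1 (of_bool (hops k a g b)) =
        tile (Suc (3 * i)) (i + b) 1 (of_bool (hops k a g' b))"
      by (rule cell_tiling.same[OF _ in_P[OF L(1)] in_P[OF L(2)], where c = "(Suc (3 * i), i + b)"])
         (use P in \<open>auto simp: tile_def cell_tiling_def\<close>)
    then show "hops k a g b = hops k a g' b" by (simp only: tile_eq_iff of_bool_eq_iff)
  qed
qed

section \<open>Layers of the upper half\<close>

definition upper_moves :: "nat \<Rightarrow> nat \<Rightarrow> (nat \<Rightarrow> nat) \<Rightarrow> (nat \<Rightarrow> nat) set" where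
  "upper_moves m s a = {x \<in> PiE {..<m} (\<lambda>l. {a l, Suc (a l)}).
     inj_on x {..<m} \<and> (\<forall>l<m. s < x l) \<and> Suc s \<in> x ` {..<m}}"

text \<open>\<open>x l\<close> is the position reached in the two middle rows. Tiles of particles
  are right stones or falling bones, since their second step is 0; the other tiles start with a step
  0 and are falling bones because \<open>e \<le> d\<close>.\<close>

definition upper_layer :: "nat \<Rightarrow> nat \<Rightarrow> nat \<Rightarrow> nat \<Rightarrow> (nat \<Rightarrow> nat) \<Rightarrow> (nat \<Rightarrow> nat) \<Rightarrow> (nat \<times> nat) set set" where
  "upper_layer N i s m a x = {tile (3 * i) (i + a l) (x l - a l) 0 | l. l < m} \<union>
     {tile (Suc (3 * i)) (i + b) 0 0 | b. s < b \<and> b < N \<and> b \<notin> x ` {..<m}}"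

lemma upper_moves_cases:
  "x \<in> upper_moves m s a \<Longrightarrow> l < m \<Longrightarrow> x l = a l \<or> x l = Suc (a l)"
  using PiE_mem[of x "{..<m}" "\<lambda>l. {a l, Suc (a l)}" l] by (auto simp: upper_moves_def)

lemma upper_layer_subset_tiles:
  assumes "x \<in> upper_moves m s a"
  shows "upper_layer N i s m a x \<subseteq> tiles"
proof
  fix t assume "t \<in> upper_layer N i s m a x"
  then consider l where "l < m" "t = tile (3 * i) (i + a l) (x l - a l) 0"
    | b where "t = tile (Suc (3 * i)) (i + b) 0 0"
    unfolding upper_layer_def by blast
  then show "t \<in> tiles"
  proof cases
    case 1
    have "x l - a l \<le> 1" using upper_moves_cases[OF assms 1(1)] by auto
    then show ?thesis using 1(2) by (auto simp: tiles_def)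
  qed (auto simp: tiles_def)
qed

context
  fixes n k i s m :: nat and a :: "nat \<Rightarrow> nat"
  assumes i: "i + 1 = n + k + s" and s: "s < k"
    and a_inj: "inj_on a {..<m}" and a_bounds: "\<forall>l<m. s \<le> a l \<and> a l + 1 < n + 2 * k"
begin

lemma upper_layer_in_tiling:
  assumes P: "P \<in> cell_tilings (upper_region n k i (a ` {..<m}))"
  shows "\<exists>x\<in>upper_moves m s a. upper_layer (n + 2 * k) i s m a x \<subseteq> P"
proof -
  let ?R = "upper_region n k i (a ` {..<m})"
  interpret cell_tiling ?R P using P by unfold_locales
  note rows = upper_rows[OF i s] upper_region_iff
  have bottom_row: "3 * i \<le> r" if "tile r p d e \<in> P" for r p d e
    using tile_in[OF that] by (auto simp: upper_region_iff)
  have middle_step: "(Suc (Suc (3 * i)), p) \<in> t"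
    if "i + s + 1 \<le> p" "p + 1 \<le> i + n + 2 * k" "t \<in> P" "(Suc (3 * i), p) \<in> t" for p t
    using that
  \<comment> \<open>The forcing now runs from right to left: at the right end a step to the right
    would leave the region.\<close>
  proof (induction "i + n + 2 * k - p" arbitrary: p t rule: less_induct)
    case less
    have "(Suc (3 * i), p) \<in> ?R" using less.prems by (simp add: rows)
    then obtain t' \<delta> where t': "t' \<in> P" "(Suc (3 * i), p) \<in> t'" "\<delta> \<le> 1" "(Suc (Suc (3 * i)), p + \<delta>) \<in> t'"
    proof (cases rule: cover)
      case (bottom d e)
      then show ?thesis using that[of "tile (Suc (3 * i)) p d e" d] tile_bounds[OF bottom]
        by (simp add: tile_def)
    next
      case (middle r' p' d e)
      then show ?thesis using that[of "tile r' p' d e" e] tile_bounds[OF middle(3)]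
        by (simp add: tile_def)
    next
      case (top r' p' d e)
      then show ?thesis using bottom_row[OF top(3)] by simp
    qed
    have "t' = t" using same t' less.prems by blast
    have "\<delta> = 0"
    proof (rule ccontr)
      assume "\<delta> \<noteq> 0"
      then have top: "(Suc (Suc (3 * i)), Suc p) \<in> t'" using t' by (cases \<delta>) auto
      then have "(Suc (Suc (3 * i)), Suc p) \<in> ?R"
        using t'(1) P by (auto simp: cell_tilings_def partition_on_def)
      then have p: "Suc p + 1 \<le> i + n + 2 * k" by (simp add: rows)
      then have "(Suc (3 * i), Suc p) \<in> ?R" using less.prems by (auto simp: rows)
      then obtain t'' where t'': "t'' \<in> P" "(Suc (3 * i), Suc p) \<in> t''"
        using P by (auto simp: cell_tilings_def partition_on_def)
      then have "(Suc (Suc (3 * i)), Suc p) \<in> t''"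
        using less.hyps[of "Suc p" t''] p less.prems by simp
      then have "t'' = t'" using same[OF t''(1) t'(1)] top by simp
      then show False using row_unique[OF t'(1) t'(2), of "Suc p"] t'' by simp
    qed
    then show ?case using t' \<open>t' = t\<close> by simp
  qed
  have straight: "e = 0" if "tile (3 * i) p d e \<in> P" for p d e
  proof -
    have "(Suc (3 * i), p + d) \<in> ?R" using tile_in[OF that] by simp
    then have "(Suc (Suc (3 * i)), p + d) \<in> tile (3 * i) p d e"
      using middle_step[of "p + d", OF _ _ that] by (simp add: rows tile_def)
    then show ?thesis by (auto simp: tile_def)
  qed
  define x where "x = (\<lambda>l\<in>{..<m}. if tile (3 * i) (i + a l) 1 0 \<in> P then Suc (a l) else a l)"
  have first: "tile (3 * i) (i + a l) (x l - a l) 0 \<in> P" if "l < m" for l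
  proof -
    have "(3 * i, i + a l) \<in> ?R" using that by (simp add: rows)
    then show ?thesis
    proof (cases rule: cover)
      case (bottom d e)
      have "d = 0 \<or> d = 1" using tile_bounds[OF bottom] by auto
      then show ?thesis using straight[OF bottom] bottom that by (auto simp: x_def)
    next
      case (middle r' p' d e)
      then show ?thesis using bottom_row[OF middle(3)] by simp
    next
      case (top r' p' d e)
      then show ?thesis using bottom_row[OF top(3)] by simp
    qed
  qed
  have second: "tile (Suc (3 * i)) (i + b) 0 0 \<in> P" if "s < b" "b < n + 2 * k" "b \<notin> x ` {..<m}" for b
  proof -
    have "(Suc (3 * i), i + b) \<in> ?R" using that by (simp add: rows)
    then show ?thesis
    proof (cases rule: cover)
      case (bottom d e)
      have "(Suc (Suc (3 * i)), i + b) \<in> tile (Suc (3 * i)) (i + b) d e"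
        using middle_step[of "i + b", OF _ _ bottom] that by (simp add: tile_def)
      then have "d = 0" by (auto simp: tile_def)
      then show ?thesis using bottom tile_bounds[OF bottom] by simp
    next
      case (middle r' p' d e)
      then have t: "tile (3 * i) p' d e \<in> P" by simp
      then obtain l where l: "l < m" "p' = i + a l" using tile_in[OF t] by (auto simp: rows)
      have "tile (3 * i) p' d e = tile (3 * i) (i + a l) (x l - a l) 0"
        by (rule same[OF t first[OF l(1)], of "(3 * i, p')"]) (simp_all add: tile_def l)
      then have "d = x l - a l" by (simp add: tile_eq_iff)
      moreover have "a l \<le> x l" using l by (simp add: x_def)
      ultimately have "b = x l" using middle(2) l by simp
      then show ?thesis using that l by blast
    next
      case (top r' p' d e)
      then show ?thesis using bottom_row[OF top(3)] by simp
    qed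
  qed
  have x_range: "s < x l \<and> x l < n + 2 * k" if "l < m" for l
  proof -
    have "a l \<le> x l" using that by (simp add: x_def)
    then show ?thesis using tile_in[OF first[OF that]] by (simp add: rows)
  qed
  have "inj_on x {..<m}"
  proof (rule inj_onI)
    fix l l' assume l: "l \<in> {..<m}" "l' \<in> {..<m}" "x l = x l'"
    have le: "a l \<le> x l" "a l' \<le> x l'" using l(1,2) by (simp_all add: x_def)
    have "tile (3 * i) (i + a l) (x l - a l) 0 = tile (3 * i) (i + a l') (x l' - a l') 0"
      by (rule same[OF first first, of _ _ "(Suc (3 * i), i + x l)"]) (use l le in \<open>simp_all add: tile_def\<close>)
    then have "a l = a l'" by (simp add: tile_eq_iff)
    then show "l = l'" using a_inj l by (simp add: inj_on_eq_iff)
  qed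
  \<comment> \<open>A falling bone starting at the left end \<open>Suc s\<close> would stick out of
    the region, so some particle must arrive there; it is the one that leaves.\<close>
  moreover have "Suc s \<in> x ` {..<m}"
  proof (rule ccontr)
    assume "Suc s \<notin> x ` {..<m}"
    then have "tile (Suc (3 * i)) (i + Suc s) 0 0 \<in> P" using second[of "Suc s"] s by simp
    from tile_in[OF this] show False by (simp add: rows)
  qed
  ultimately have "x \<in> upper_moves m s a"
    using x_range by (auto simp: upper_moves_def x_def)
  moreover have "upper_layer (n + 2 * k) i s m a x \<subseteq> P"
    unfolding upper_layer_def using first second by blast
  ultimately show ?thesis by blast
qed

lemma upper_layer_partition:
  assumes x: "x \<in> upper_moves m s a"
  shows "partition_on (upper_region n k i (a ` {..<m}) -
      upper_region n k (Suc i) {y. s < y \<and> Suc y \<in> x ` {..<m}}) (upper_layer (n + 2 * k) i s m a x)"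
proof (rule partition_onI_unique)
  let ?D = "upper_region n k i (a ` {..<m}) - upper_region n k (Suc i) {y. s < y \<and> Suc y \<in> x ` {..<m}}"
  let ?L = "upper_layer (n + 2 * k) i s m a x"
  note rows = upper_rows[OF i s] upper_region_iff
  have x_inj: "inj_on x {..<m}" and Suc_s: "Suc s \<in> x ` {..<m}" and x_gt: "\<And>l. l < m \<Longrightarrow> s < x l"
    using x by (auto simp: upper_moves_def)
  have x_ge: "a l \<le> x l" "x l < n + 2 * k" if "l < m" for l
    using upper_moves_cases[OF x that] a_bounds that by auto
  \<comment> \<open>The next configuration is measured from \<open>Suc i\<close>, so an uncovered
    cell at \<open>x l\<close> is listed as \<open>x l - 1\<close>; this is the origin of
    \<open>Suc y\<close>.\<close>
  have top_row: "(p - Suc i \<in> {y. s < y \<and> Suc y \<in> x ` {..<m}}) \<longleftrightarrow> p - i \<in> x ` {..<m}"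
    if "i + s + 2 \<le> p" for p
  proof -
    have "Suc (p - Suc i) = p - i" "s < p - Suc i" using that by auto
    then show ?thesis by simp
  qed
  have D: "(r, p) \<in> ?D \<longleftrightarrow> (r = 3 * i \<and> i \<le> p \<and> p - i \<in> a ` {..<m}) \<or>
      ((r = Suc (3 * i) \<or> r = Suc (Suc (3 * i))) \<and> i + s + 1 \<le> p \<and> p + 1 \<le> i + n + 2 * k) \<or>
      (r = Suc (Suc (Suc (3 * i))) \<and> i + s + 2 \<le> p \<and> p + 1 \<le> i + n + 2 * k \<and> p - i \<notin> x ` {..<m})" for r p
  proof -
    consider "r \<le> 3 * i" | "r = Suc (3 * i)" | "r = Suc (Suc (3 * i))"
      | "r = Suc (Suc (Suc (3 * i)))" | "r > Suc (Suc (Suc (3 * i)))" by linarith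
    then show ?thesis
    proof cases
      case 4
      then have "(r, p) \<in> ?D \<longleftrightarrow> i + s + 2 \<le> p \<and> p + 1 \<le> i + n + 2 * k \<and>
          p - Suc i \<notin> {y. s < y \<and> Suc y \<in> x ` {..<m}}"
        by (auto simp: rows simp del: mem_Collect_eq)
      then show ?thesis using 4 top_row[of p] by auto
    qed (auto simp: rows)
  qed
  have first: "tile (3 * i) (i + a l) (x l - a l) 0 \<in> ?L" if "l < m" for l
    using that unfolding upper_layer_def by blast
  have second: "tile (Suc (3 * i)) (i + b) 0 0 \<in> ?L" if "s < b" "b < n + 2 * k" "b \<notin> x ` {..<m}" for b
    using that unfolding upper_layer_def by blast
  show "\<Union> ?L = ?D"
  proof (rule Set.set_eqI)
    fix c :: "nat \<times> nat"
    obtain r p where c: "c = (r, p)" by (cases c)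
    show "c \<in> \<Union> ?L \<longleftrightarrow> c \<in> ?D"
      unfolding c
    proof
      assume "(r, p) \<in> \<Union> ?L"
      then consider l where "l < m" "(r, p) \<in> tile (3 * i) (i + a l) (x l - a l) 0"
        | b where "s < b" "b < n + 2 * k" "b \<notin> x ` {..<m}" "(r, p) \<in> tile (Suc (3 * i)) (i + b) 0 0"
        unfolding upper_layer_def by blast
      then show "(r, p) \<in> ?D"
      proof cases
        case 1
        then have "(r = 3 * i \<and> p = i + a l) \<or>
            ((r = Suc (3 * i) \<or> r = Suc (Suc (3 * i))) \<and> p = i + x l)"
          using x_ge[of l] by (auto simp: tile_def)
        then show ?thesis unfolding D using 1 x_ge[of l] x_gt[of l] by auto
      next
        case 2
        then have "b \<noteq> Suc s" using Suc_s by blast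
        moreover have "(r = Suc (3 * i) \<or> r = Suc (Suc (3 * i)) \<or> r = Suc (Suc (Suc (3 * i)))) \<and> p = i + b"
          using 2 by (auto simp: tile_def)
        ultimately show ?thesis unfolding D using 2 by auto
      qed
    next
      assume "(r, p) \<in> ?D"
      then consider "r = 3 * i" "i \<le> p" "p - i \<in> a ` {..<m}"
        | "r = Suc (3 * i) \<or> r = Suc (Suc (3 * i))" "i + s + 1 \<le> p" "p + 1 \<le> i + n + 2 * k"
        | "r = Suc (Suc (Suc (3 * i)))" "i + s + 2 \<le> p" "p + 1 \<le> i + n + 2 * k" "p - i \<notin> x ` {..<m}"
        unfolding D by blast
      then show "(r, p) \<in> \<Union> ?L"
      proof cases
        case 1
        then obtain l where "l < m" "p = i + a l" by auto
        moreover have "(r, p) \<in> tile (3 * i) (i + a l) (x l - a l) 0"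
          using 1 calculation by (simp add: tile_def)
        ultimately show ?thesis using first by blast
      next
        case 2
        show ?thesis
        proof (cases "p - i \<in> x ` {..<m}")
          case True
          then obtain l where l: "l < m" "p = i + x l" using 2 by auto
          then have "(r, p) \<in> tile (3 * i) (i + a l) (x l - a l) 0"
            using 2 x_ge[of l] by (auto simp: tile_def)
          then show ?thesis using first l by blast
        next
          case False
          have "(r, p) \<in> tile (Suc (3 * i)) (i + (p - i)) 0 0" using 2 by (auto simp: tile_def)
          moreover have "s < p - i" "p - i < n + 2 * k" using 2 by auto
          ultimately show ?thesis using second False by blast
        qed
      next
        case 3
        have "(r, p) \<in> tile (Suc (3 * i)) (i + (p - i)) 0 0" using 3 by (auto simp: tile_def)
        moreover have "s < p - i" "p - i < n + 2 * k" using 3 by auto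
        ultimately show ?thesis using second 3 by blast
      qed
    qed
  qed
  show "{} \<notin> ?L" by (auto simp: upper_layer_def tile_def)
  show "t = t'" if t: "t \<in> ?L" "t' \<in> ?L" "c \<in> t" "c \<in> t'" for c t t'
  proof -
    have cases_layer: "(\<exists>l. l < m \<and> u = tile (3 * i) (i + a l) (x l - a l) 0) \<or>
        (\<exists>b. b \<notin> x ` {..<m} \<and> u = tile (Suc (3 * i)) (i + b) 0 0)"
      if "u \<in> ?L" for u
      using that unfolding upper_layer_def by blast
    have mixed: False if l: "l < m" and b: "b \<notin> x ` {..<m}" and c: "c \<in> tile (3 * i) (i + a l) (x l - a l) 0"
      "c \<in> tile (Suc (3 * i)) (i + b) 0 0" for l b
    proof -
      have "b = x l" using c x_ge[OF l] by (auto simp: tile_def)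
      then show False using l b by simp
    qed
    show ?thesis
      using cases_layer[OF t(1)] cases_layer[OF t(2)]
    proof (elim disjE exE conjE)
      fix l l' assume l: "l < m" "t = tile (3 * i) (i + a l) (x l - a l) 0"
        "l' < m" "t' = tile (3 * i) (i + a l') (x l' - a l') 0"
      then have "a l = a l' \<or> x l = x l'"
        using t(3,4) x_ge[of l] x_ge[of l'] by (auto simp: tile_def)
      then have "l = l'" using l a_inj x_inj by (auto simp: inj_on_eq_iff)
      then show ?thesis using l by simp
    next
      fix l b assume "l < m" "t = tile (3 * i) (i + a l) (x l - a l) 0"
        "b \<notin> x ` {..<m}" "t' = tile (Suc (3 * i)) (i + b) 0 0"
      then show ?thesis using mixed[of l b] t(3,4) by simp
    next
      fix l b assume "l < m" "t' = tile (3 * i) (i + a l) (x l - a l) 0"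
        "b \<notin> x ` {..<m}" "t = tile (Suc (3 * i)) (i + b) 0 0"
      then show ?thesis using mixed[of l b] t(3,4) by simp
    next
      fix b b' assume b: "t = tile (Suc (3 * i)) (i + b) 0 0" "t' = tile (Suc (3 * i)) (i + b') 0 0"
      then have "b = b'" using t(3,4) by (auto simp: tile_def)
      then show ?thesis using b by simp
    qed
  qed
qed

lemma card_cell_tilings_upper:
  "card (cell_tilings (upper_region n k i (a ` {..<m}))) =
    (\<Sum>x\<in>upper_moves m s a.
      card (cell_tilings (upper_region n k (Suc i) {y. s < y \<and> Suc y \<in> x ` {..<m}})))"
proof (rule card_cell_tilings_split)
  let ?R = "upper_region n k i (a ` {..<m})"
  let ?L = "upper_layer (n + 2 * k) i s m a"
  show "finite ?R" by (rule finite_upper_region) simp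
  show "finite (upper_moves m s a)"
    by (rule finite_subset[of _ "PiE {..<m} (\<lambda>l. {a l, Suc (a l)})"])
       (auto simp: upper_moves_def intro!: finite_PiE)
  show "upper_region n k (Suc i) {y. s < y \<and> Suc y \<in> x ` {..<m}} \<subseteq> ?R"
    if x: "x \<in> upper_moves m s a" for x
  proof
    fix c assume c: "c \<in> upper_region n k (Suc i) {y. s < y \<and> Suc y \<in> x ` {..<m}}"
    obtain r p where rp: "c = (r, p)" by (cases c)
    have "(r, p) \<in> region n k"
      if row: "r = 3 * Suc i" "Suc i \<le> p" "p - Suc i \<in> {y. s < y \<and> Suc y \<in> x ` {..<m}}"
    proof -
      obtain l where l: "l < m" "Suc (p - Suc i) = x l" "s < p - Suc i" using row by auto
      moreover have "x l < n + 2 * k" using upper_moves_cases[OF x l(1)] a_bounds l(1) by auto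
      moreover have r: "r = Suc (Suc (Suc (3 * i)))" using row(1) by simp
      ultimately show ?thesis using upper_rows(3)[OF i s, of p] row(2) unfolding r by auto
    qed
    then show "c \<in> ?R" using c unfolding rp upper_region_iff by auto
  qed
  show "partition_on (?R - upper_region n k (Suc i) {y. s < y \<and> Suc y \<in> x ` {..<m}}) (?L x)"
    if "x \<in> upper_moves m s a" for x
    using that by (rule upper_layer_partition)
  show "?L x \<subseteq> tiles" if "x \<in> upper_moves m s a" for x
    using that by (rule upper_layer_subset_tiles)
  show "\<exists>x\<in>upper_moves m s a. ?L x \<subseteq> P" if "P \<in> cell_tilings ?R" for P
    using that by (rule upper_layer_in_tiling)
  show "x = x'" if P: "P \<in> cell_tilings ?R" and x: "x \<in> upper_moves m s a" "x' \<in> upper_moves m s a"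
    and L: "?L x \<subseteq> P" "?L x' \<subseteq> P" for P x x'
  proof (rule PiE_ext)
    show "x \<in> PiE {..<m} (\<lambda>l. {a l, Suc (a l)})" "x' \<in> PiE {..<m} (\<lambda>l. {a l, Suc (a l)})"
      using x by (auto simp: upper_moves_def)
    fix l assume "l \<in> {..<m}"
    then have l: "l < m" by simp
    have in_P: "tile (3 * i) (i + a l) (h l - a l) 0 \<in> P" if "?L h \<subseteq> P" for h
      using that l unfolding upper_layer_def by blast
    have "tile (3 * i) (i + a l) (x l - a l) 0 = tile (3 * i) (i + a l) (x' l - a l) 0"
      by (rule cell_tiling.same[OF _ in_P[OF L(1)] in_P[OF L(2)], where c = "(3 * i, i + a l)"])
         (use P in \<open>auto simp: tile_def cell_tiling_def\<close>)
    then show "x l = x' l"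
      using upper_moves_cases[OF x(1) l] upper_moves_cases[OF x(2) l] by (auto simp: tile_eq_iff)
  qed
qed

end

section \<open>Counting by determinants\<close>

text \<open>Moves by at most one keep the order weakly, and injectivity makes it strict. Hence the
  particle that leaves is the first one.\<close>

lemma fdet_upper_step:
  assumes a: "strict_mono_on {..<m} a" "\<forall>l<m. s \<le> a l" and "x \<in> upper_moves m s a"
  shows "x 0 = Suc s \<and> strict_mono_on {..<m} x \<and> m > 0"
proof -
  have inj: "inj_on x {..<m}" and gt: "\<And>l. l < m \<Longrightarrow> s < x l" and Suc_s: "Suc s \<in> x ` {..<m}"
    using assms(3) by (auto simp: upper_moves_def)
  have mono: "strict_mono_on {..<m} x"
  proof (rule strict_mono_onI)
    fix l l' assume l: "l \<in> {..<m}" "l' \<in> {..<m}" "l < l'"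
    then have "a l < a l'" using strict_mono_onD[OF a(1), of l l'] by simp
    then have "x l \<le> x l'"
      using upper_moves_cases[OF assms(3), of l] upper_moves_cases[OF assms(3), of l'] l by auto
    moreover have "x l \<noteq> x l'" using inj l by (auto simp: inj_on_eq_iff)
    ultimately show "x l < x l'" by simp
  qed
  obtain l where l: "l < m" "x l = Suc s" using Suc_s by auto
  have "l = 0"
  proof (rule ccontr)
    assume "l \<noteq> 0"
    then have "x 0 < x l" using strict_mono_onD[OF mono, of 0 l] l(1) by simp
    then show False using gt[of 0] l by simp
  qed
  then show ?thesis using l mono by auto
qed

text \<open>Column 0 of \<open>E\<close> is the indicator of \<open>Suc s\<close>, and every column
  vanishes up to \<open>s\<close>. Forbidden moves therefore give equal rows, a zero row or a zero
  column, so the sum extends to all independent moves; multilinearity and Pascal's rule then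
  apply.\<close>

lemma fdet_upper_moves:
  assumes a: "strict_mono_on {..<Suc m} a" "\<forall>l<Suc m. s \<le> a l"
  shows "(\<Sum>x\<in>upper_moves (Suc m) s a.
      fdet m (\<lambda>l j. shifted_binomial (Suc j) (Suc s + j) (x (Suc l) - 1))) =
    fdet (Suc m) (\<lambda>l j. shifted_binomial (Suc j) (s + j) (a l))"
proof -
  define E where "E j x = shifted_binomial j (Suc (s + j)) x" for j x
  let ?X = "\<lambda>l. {a l, Suc (a l)}"
  let ?F = "\<lambda>x. fdet (Suc m) (\<lambda>l j. E j (x l))"
  have "(\<Sum>x\<in>upper_moves (Suc m) s a.
      fdet m (\<lambda>l j. shifted_binomial (Suc j) (Suc s + j) (x (Suc l) - 1))) =
      (\<Sum>x\<in>upper_moves (Suc m) s a. ?F x)"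
  proof (rule sum.cong, rule refl)
    fix x assume x: "x \<in> upper_moves (Suc m) s a"
    then have x0: "x 0 = Suc s" using fdet_upper_step[OF a x] by simp
    have gt: "s < x l" if "l < Suc m" for l using x that by (auto simp: upper_moves_def)
    \<comment> \<open>At \<open>Suc s\<close> all columns except the first vanish; this is how the
      departing particle accounts for one row and one column.\<close>
    have "?F x = E 0 (x 0) * fdet m (\<lambda>l j. E (Suc j) (x (Suc l)))"
      by (rule fdet_first_row) (simp add: E_def x0 shifted_binomial_def)
    also have "E 0 (x 0) = 1" by (simp add: E_def x0 shifted_binomial_0)
    also have "fdet m (\<lambda>l j. E (Suc j) (x (Suc l))) =
        fdet m (\<lambda>l j. shifted_binomial (Suc j) (Suc s + j) (x (Suc l) - 1))"
    proof (rule fdet_cong)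
      fix l j assume "l < m"
      then obtain y where "x (Suc l) = Suc y" using gt[of "Suc l"] by (cases "x (Suc l)") auto
      then show "E (Suc j) (x (Suc l)) = shifted_binomial (Suc j) (Suc s + j) (x (Suc l) - 1)"
        by (simp add: E_def shifted_binomial_shift)
    qed
    finally show "fdet m (\<lambda>l j. shifted_binomial (Suc j) (Suc s + j) (x (Suc l) - 1)) = ?F x" by simp
  qed
  also have "\<dots> = (\<Sum>x\<in>PiE {..<Suc m} ?X. ?F x)"
  proof (rule sum.mono_neutral_left)
    show "finite (PiE {..<Suc m} ?X)" by (intro finite_PiE) auto
    show "upper_moves (Suc m) s a \<subseteq> PiE {..<Suc m} ?X" by (auto simp: upper_moves_def)
    show "\<forall>x\<in>PiE {..<Suc m} ?X - upper_moves (Suc m) s a. ?F x = 0"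
    proof
      fix x assume "x \<in> PiE {..<Suc m} ?X - upper_moves (Suc m) s a"
      then consider "\<not> inj_on x {..<Suc m}" | l where "l < Suc m" "\<not> s < x l"
        | "\<forall>l<Suc m. s < x l" "Suc s \<notin> x ` {..<Suc m}"
        unfolding upper_moves_def by blast
      then show "?F x = 0"
      proof cases
        case 1
        then obtain l l' where "l < Suc m" "l' < Suc m" "l \<noteq> l'" "x l = x l'"
          by (auto simp: inj_on_def)
        then show ?thesis by (intro fdet_equal_rows[of l _ l']) auto
      next
        case 2
        then show ?thesis by (intro fdet_zero_row[of l]) (auto simp: E_def shifted_binomial_def)
      next
        case 3
        then have "E 0 (x l) = 0" if "l < Suc m" for l
          using that by (force simp: E_def shifted_binomial_0)
        then show ?thesis by (intro fdet_zero_column[of 0]) auto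
      qed
    qed
  qed
  also have "\<dots> = fdet (Suc m) (\<lambda>l j. \<Sum>y\<in>?X l. E j y)" by (rule fdet_sum_rows) simp
  also have "\<dots> = fdet (Suc m) (\<lambda>l j. shifted_binomial (Suc j) (s + j) (a l))"
    by (rule fdet_cong) (simp add: E_def shifted_binomial_shift shifted_binomial_Suc)
  finally show ?thesis .
qed

lemma cell_tilings_empty: "cell_tilings {} = {{}}"
  by (auto simp: cell_tilings_def partition_on_def)

lemma card_upper_region_upper:
  assumes "m \<le> k" "strict_mono_on {..<m} a" "\<forall>l<m. k - m \<le> a l \<and> a l + 1 < n + 2 * k" "n \<ge> 1"
  shows "real (card (cell_tilings (upper_region n k (n + k - 1 + (k - m)) (a ` {..<m})))) =
    fdet m (\<lambda>l j. shifted_binomial (Suc j) (k - m + j) (a l))"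
  using assms
proof (induction m arbitrary: a)
  case 0
  \<comment> \<open>At this index row \<open>3 * i\<close> is the top row of the benzel, and no
    particle is left in it.\<close>
  have "upper_region n k (n + k - 1 + (k - 0)) (a ` {..<0}) = {}"
    using \<open>n \<ge> 1\<close> by (auto simp: upper_region_def region_def)
  then show ?case by (simp add: cell_tilings_empty)
next
  case (Suc m)
  define s where "s = k - Suc m"
  define i where "i = n + k - 1 + s"
  have s: "s < k" "k - m = Suc s" and i: "i + 1 = n + k + s"
    using Suc.prems by (auto simp: s_def i_def)
  have a: "inj_on a {..<Suc m}" "\<forall>l<Suc m. s \<le> a l \<and> a l + 1 < n + 2 * k" "\<forall>l<Suc m. s \<le> a l"
    using Suc.prems strict_mono_on_imp_inj_on by (auto simp: s_def)
  have "real (card (cell_tilings (upper_region n k i (a ` {..<Suc m})))) =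
      (\<Sum>x\<in>upper_moves (Suc m) s a.
        real (card (cell_tilings (upper_region n k (Suc i) {y. s < y \<and> Suc y \<in> x ` {..<Suc m}}))))"
    by (simp add: card_cell_tilings_upper[OF i s(1) a(1,2)])
  also have "\<dots> = (\<Sum>x\<in>upper_moves (Suc m) s a.
      fdet m (\<lambda>l j. shifted_binomial (Suc j) (Suc s + j) (x (Suc l) - 1)))"
  proof (rule sum.cong, rule refl)
    fix x assume x: "x \<in> upper_moves (Suc m) s a"
    have x0: "x 0 = Suc s" and mono: "strict_mono_on {..<Suc m} x"
      using fdet_upper_step[OF Suc.prems(2) a(3) x] by auto
    have gt: "Suc s < x (Suc l)" if "l < m" for l
      using strict_mono_onD[OF mono, of 0 "Suc l"] that x0 by simp
    have "{y. s < y \<and> Suc y \<in> x ` {..<Suc m}} = (\<lambda>l. x (Suc l) - 1) ` {..<m}"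
    proof (intro equalityI subsetI)
      fix y assume "y \<in> {y. s < y \<and> Suc y \<in> x ` {..<Suc m}}"
      then obtain l where l: "l < Suc m" "x l = Suc y" "s < y" by auto
      then obtain l' where "l = Suc l'" using x0 by (cases l) auto
      then show "y \<in> (\<lambda>l. x (Suc l) - 1) ` {..<m}" using l by (auto intro!: image_eqI[of _ _ l'])
    next
      fix y assume "y \<in> (\<lambda>l. x (Suc l) - 1) ` {..<m}"
      then obtain l where l: "l < m" "y = x (Suc l) - 1" by auto
      then have "s < y" "Suc y = x (Suc l)" using gt[of l] by auto
      then show "y \<in> {y. s < y \<and> Suc y \<in> x ` {..<Suc m}}" using l(1) by auto
    qed
    moreover have "real (card (cell_tilings (upper_region n k (n + k - 1 + (k - m)) ((\<lambda>l. x (Suc l) - 1) ` {..<m})))) =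
        fdet m (\<lambda>l j. shifted_binomial (Suc j) (k - m + j) (x (Suc l) - 1))"
    proof (rule Suc.IH)
      show "strict_mono_on {..<m} (\<lambda>l. x (Suc l) - 1)"
      proof (rule strict_mono_onI)
        fix l l' assume "l \<in> {..<m}" "l' \<in> {..<m}" "l < l'"
        then show "x (Suc l) - 1 < x (Suc l') - 1"
          using strict_mono_onD[OF mono, of "Suc l" "Suc l'"] gt[of l] by auto
      qed
      show "\<forall>l<m. k - m \<le> x (Suc l) - 1 \<and> x (Suc l) - 1 + 1 < n + 2 * k"
      proof (intro allI impI)
        fix l assume "l < m"
        then have "x (Suc l) < n + 2 * k"
          using upper_moves_cases[OF x, of "Suc l"] a(2) by auto
        then show "k - m \<le> x (Suc l) - 1 \<and> x (Suc l) - 1 + 1 < n + 2 * k"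
          using gt[OF \<open>l < m\<close>] s(2) by auto
      qed
    qed (use Suc.prems in simp_all)
    ultimately show "real (card (cell_tilings (upper_region n k (Suc i) {y. s < y \<and> Suc y \<in> x ` {..<Suc m}}))) =
        fdet m (\<lambda>l j. shifted_binomial (Suc j) (Suc s + j) (x (Suc l) - 1))"
      unfolding s(2) i_def by simp
  qed
  also have "\<dots> = fdet (Suc m) (\<lambda>l j. shifted_binomial (Suc j) (s + j) (a l))"
    by (rule fdet_upper_moves[OF Suc.prems(2) a(3)])
  finally show ?case by (simp add: s_def i_def)
qed

text \<open>The intervals for the first l + 1 particles partition {0, ..., a_l + 1}, so the sums
  over them are differences of consecutive partial sums, and row operations undo the
  differences.\<close>

lemma fdet_interlacing:
  assumes a: "strict_mono_on {..<k} a"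
  shows "(\<Sum>g\<in>interlacing k a. fdet k (\<lambda>l j. F j (g l))) = fdet k (\<lambda>l j. partial_sum (F j) (a l))"
proof -
  have "(\<Sum>g\<in>interlacing k a. fdet k (\<lambda>l j. F j (g l))) =
      fdet k (\<lambda>l j. \<Sum>y\<in>{gap_start a l..Suc (a l)}. F j y)"
    unfolding interlacing_def by (rule fdet_sum_rows) simp
  also have "\<dots> = fdet k (\<lambda>l j. partial_sum (F j) (a l))"
  proof (rule fdet_diff_rows)
    show "(\<Sum>y\<in>{gap_start a 0..Suc (a 0)}. F j y) = partial_sum (F j) (a 0)" for j
      by (simp add: gap_start_def partial_sum_def atLeast0AtMost)
    fix l j assume "Suc l < k"
    then have "a l < a (Suc l)" using strict_mono_onD[OF a, of l "Suc l"] by simp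
    then have "{..Suc (a (Suc l))} = {..Suc (a l)} \<union> {gap_start a (Suc l)..Suc (a (Suc l))}"
      by (auto simp: gap_start_def)
    moreover have "{..Suc (a l)} \<inter> {gap_start a (Suc l)..Suc (a (Suc l))} = {}"
      by (auto simp: gap_start_def)
    ultimately have "partial_sum (F j) (a (Suc l)) =
        partial_sum (F j) (a l) + (\<Sum>y\<in>{gap_start a (Suc l)..Suc (a (Suc l))}. F j y)"
      unfolding partial_sum_def by (simp only: sum.union_disjoint finite_atMost finite_atLeastAtMost)
    then show "(\<Sum>y\<in>{gap_start a (Suc l)..Suc (a (Suc l))}. F j y) =
        partial_sum (F j) (a (Suc l)) - partial_sum (F j) (a l)" by simp
  qed
  finally show ?thesis .
qed

text \<open>\<open>t\<close> is the number of lower layers still below the row where the upper half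
  takes over.\<close>

lemma card_upper_region_lower:
  assumes "t \<le> n + k - 1" "strict_mono_on {..<k} a" "\<forall>l<k. a l < k + (n + k - 1 - t)" "n \<ge> 1"
  shows "real (card (cell_tilings (upper_region n k (n + k - 1 - t) (a ` {..<k})))) =
    fdet k (\<lambda>l j. (partial_sum ^^ t) (shifted_binomial (Suc j) j) (a l))"
  using assms
proof (induction t arbitrary: a)
  case 0
  have "\<forall>l<k. k - k \<le> a l \<and> a l + 1 < n + 2 * k"
  proof (intro allI impI)
    fix l assume "l < k"
    then have "a l < k + (n + k - 1 - 0)" using "0.prems" by blast
    then show "k - k \<le> a l \<and> a l + 1 < n + 2 * k" using \<open>n \<ge> 1\<close> by simp
  qed
  then show ?case using card_upper_region_upper[of k k a n] "0.prems" by simp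
next
  case (Suc t)
  define i where "i = n + k - 1 - Suc t"
  have i: "i + 2 \<le> n + k" "n + k - 1 - t = Suc i" using Suc.prems by (auto simp: i_def)
  have bound: "\<forall>l<k. a l < k + i" using Suc.prems by (simp add: i_def)
  have "real (card (cell_tilings (upper_region n k i (a ` {..<k})))) =
      (\<Sum>g\<in>interlacing k a. real (card (cell_tilings (upper_region n k (Suc i) (g ` {..<k})))))"
    by (simp add: card_cell_tilings_lower[OF i(1) Suc.prems(2) bound])
  also have "\<dots> = (\<Sum>g\<in>interlacing k a. fdet k (\<lambda>l j. (partial_sum ^^ t) (shifted_binomial (Suc j) j) (g l)))"
  proof (rule sum.cong, rule refl)
    fix g assume g: "g \<in> interlacing k a"
    show "real (card (cell_tilings (upper_region n k (Suc i) (g ` {..<k})))) =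
        fdet k (\<lambda>l j. (partial_sum ^^ t) (shifted_binomial (Suc j) j) (g l))"
      using Suc.IH[of g] Suc.prems(1,4) interlacing_mono[OF Suc.prems(2) bound g]
        interlacing_bound[OF Suc.prems(2) bound g] unfolding i(2) by simp
  qed
  also have "\<dots> = fdet k (\<lambda>l j. (partial_sum ^^ Suc t) (shifted_binomial (Suc j) j) (a l))"
    by (subst fdet_interlacing[OF Suc.prems(2)]) simp
  finally show ?case by (simp add: i_def)
qed

text \<open>No tile comes from below the bottom row, so all its \<open>k\<close> cells are particles
  and the initial configuration is \<open>id\<close>.\<close>

lemma region_eq_upper_region:
  assumes "n \<ge> 1"
  shows "region n k = upper_region n k 0 {..<k}"
proof (rule Set.set_eqI)
  fix c :: "nat \<times> nat"
  obtain r p where "c = (r, p)" by (cases c)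
  then show "c \<in> region n k \<longleftrightarrow> c \<in> upper_region n k 0 {..<k}"
    using assms by (cases r) (auto simp: upper_region_iff region_def)
qed

lemma card_cell_tilings_region:
  assumes "n \<ge> 1"
  shows "real (card (cell_tilings (region n k))) =
    (\<Prod>j = 1..k. (fact (2 * j) * fact (2 * j + 2 * n - 2)) / (fact (j + n - 1) * fact (j + n + k - 1)))"
proof -
  have "real (card (cell_tilings (region n k))) =
      fdet k (\<lambda>l j. (partial_sum ^^ (n + k - 1)) (shifted_binomial (Suc j) j) l)"
    using card_upper_region_lower[of "n + k - 1" n k id] assms
    by (simp add: region_eq_upper_region strict_mono_on_def)
  then have "real (card (cell_tilings (region n k))) = 2 ^ k * fact k * \<bar>fdet k (\<lambda>i j. catalan (n + i + j))\<bar>"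
    using abs_fdet_partial_sums[OF assms, of k] by (metis abs_of_nat)
  also have "fdet k (\<lambda>i j. catalan (n + i + j)) =
      (\<Prod>r<k. fact (2 * r + 1) * fact (2 * n + 2 * r)) / (\<Prod>r<k. fact (n + 2 * r) * fact (n + 2 * r + 1))"
    by (simp only: hankel_catalan prod_dividef)
  \<comment> \<open>Even and odd offsets interleave to one run of 2k factorials, which is then cut
    in the middle to match the denominator of the claim.\<close>
  also have "(\<Prod>r<k. fact (n + 2 * r) * fact (n + 2 * r + 1)) = (\<Prod>r<2 * k. fact (n + r) :: real)"
    by (induction k) (simp_all del: fact_Suc add: add.assoc)
  also have "\<dots> = (\<Prod>r<k. fact (n + r)) * (\<Prod>r<k. fact (n + k + r))"
  proof -
    have "(\<Prod>r<k + b. fact (n + r) :: real) = (\<Prod>r<k. fact (n + r)) * (\<Prod>r<b. fact (n + k + r))" for b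
      by (induction b) (simp_all add: mult.assoc add.assoc)
    from this[of k] show ?thesis by (simp add: mult_2)
  qed
  also have "2 ^ k * fact k * \<bar>(\<Prod>r<k. fact (2 * r + 1) * fact (2 * n + 2 * r)) /
        ((\<Prod>r<k. fact (n + r)) * (\<Prod>r<k. fact (n + k + r)))\<bar> =
      2 ^ k * fact k * ((\<Prod>r<k. fact (2 * r + 1) * fact (2 * n + 2 * r)) /
        ((\<Prod>r<k. fact (n + r)) * (\<Prod>r<k. fact (n + k + r))) :: real)"
    by (subst abs_of_nonneg) (auto intro!: divide_nonneg_nonneg mult_nonneg_nonneg prod_nonneg)
  \<comment> \<open>These factors 2(r + 1) extend (2r + 1)! to (2r + 2)!.\<close>
  also have "2 ^ k * fact k = (\<Prod>r<k. 2 * real (Suc r))"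
    by (simp only: prod.distrib fact_prod_Suc atLeast0LessThan prod_constant card_lessThan of_nat_prod)
  also have "(\<Prod>r<k. 2 * real (Suc r)) * ((\<Prod>r<k. fact (2 * r + 1) * fact (2 * n + 2 * r)) /
        ((\<Prod>r<k. fact (n + r)) * (\<Prod>r<k. fact (n + k + r)))) =
      (\<Prod>r<k. 2 * real (Suc r) * (fact (2 * r + 1) * fact (2 * n + 2 * r)) / (fact (n + r) * fact (n + k + r)))"
    by (simp only: prod_dividef prod.distrib times_divide_eq_right)
  also have "\<dots> = (\<Prod>r<k. (fact (2 * Suc r) * fact (2 * Suc r + 2 * n - 2)) / (fact (Suc r + n - 1) * fact (Suc r + n + k - 1)))"
  proof (rule prod.cong, rule refl)
    fix r
    have "fact (2 * Suc r) = 2 * real (Suc r) * fact (2 * r + 1)"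
      using fact_Suc[of "2 * r + 1", where 'a = real] by (simp del: fact_Suc)
    moreover have "2 * Suc r + 2 * n - 2 = 2 * n + 2 * r" "Suc r + n - 1 = n + r" "Suc r + n + k - 1 = n + k + r"
      by simp_all
    ultimately show "2 * real (Suc r) * (fact (2 * r + 1) * fact (2 * n + 2 * r)) / (fact (n + r) * fact (n + k + r)) =
        (fact (2 * Suc r) * fact (2 * Suc r + 2 * n - 2)) / (fact (Suc r + n - 1) * fact (Suc r + n + k - 1))"
      by (simp only: mult.assoc)
  qed
  also have "\<dots> = (\<Prod>j = 1..k. (fact (2 * j) * fact (2 * j + 2 * n - 2)) / (fact (j + n - 1) * fact (j + n + k - 1)))"
    by (simp only: One_nat_def prod.atLeast1_atMost_eq)
  finally show ?thesis .
qed

section \<open>The geometry of the benzel\<close>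

text \<open>In the basis 1, \<open>omega\<close> the sides of all hexagons involved are level lines
  of x, y and x - y.\<close>

definition coord :: "real \<Rightarrow> real \<Rightarrow> complex" where
  "coord x y = of_real x + of_real y * omega"

definition xcoord :: "complex \<Rightarrow> real" where
  "xcoord z = Re z + Im z / sqrt 3"

definition ycoord :: "complex \<Rightarrow> real" where
  "ycoord z = 2 * Im z / sqrt 3"

lemma omega_eq: "omega = Complex (- 1 / 2) (sqrt 3 / 2)"
proof -
  have "omega = cis (2 * pi / 3)"
    unfolding omega_def cis_conv_exp by (simp add: mult_ac)
  then show ?thesis by (simp only: complex_eq_iff cis.sel complex.sel cos_120 sin_120)
qed

lemma Re_coord: "Re (coord x y) = x - y / 2" and Im_coord: "Im (coord x y) = y * sqrt 3 / 2"
  by (simp_all add: coord_def omega_eq)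

lemma xcoord_coord [simp]: "xcoord (coord x y) = x" and ycoord_coord [simp]: "ycoord (coord x y) = y"
  by (simp_all add: xcoord_def ycoord_def Re_coord Im_coord)

lemma coord_add: "coord x y + coord x' y' = coord (x + x') (y + y')"
  by (simp add: coord_def algebra_simps)

lemma coord_zero: "coord 0 0 = 0"
  by (simp add: coord_def)

lemma coord_eq_iff: "coord x y = coord x' y' \<longleftrightarrow> x = x' \<and> y = y'"
  by (metis xcoord_coord ycoord_coord)

lemma coord_scale: "of_real t * coord x y = coord (t * x) (t * y)"
  by (simp add: coord_def algebra_simps)

lemma coord_constants:
  "3/2 + of_real (sqrt 3) / 2 * \<i> = coord 2 1"
  "3/2 - of_real (sqrt 3) / 2 * \<i> = coord 1 (-1)"
  "of_real (sqrt 3) * \<i> = coord 1 2"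
  by (simp_all add: complex_eq_iff Re_coord Im_coord)

lemma omega_powers:
  "{f (omega ^ j) | j :: nat. j < 3} = {f (coord 1 0), f (coord 0 1), f (coord (-1) (-1))}"
proof -
  have "{f (omega ^ j) | j :: nat. j < 3} = {f (omega ^ 0), f (omega ^ 1), f (omega ^ 2)}"
  proof -
    have "{f (omega ^ j) | j :: nat. j < 3} = (\<lambda>j. f (omega ^ j)) ` {..<3}" by auto
    moreover have "{..<3 :: nat} = {0, 1, 2}" by auto
    ultimately show ?thesis by simp
  qed
  moreover have "omega ^ 0 = coord 1 0" "omega ^ 1 = coord 0 1" by (simp_all add: coord_def)
  moreover have "omega ^ 2 = coord (-1) (-1)"
    by (simp add: complex_eq_iff Re_coord Im_coord omega_eq power2_eq_square)
  ultimately show ?thesis by simp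
qed

lemma hex_cell_coord:
  "hex_cell (coord x y) = convex hull {coord (x + 1) y, coord x (y + 1), coord (x - 1) (y - 1),
     coord (x - 1) y, coord x (y - 1), coord (x + 1) (y + 1)}"
proof -
  have minus: "c - coord u v = c + coord (- u) (- v)" for c u v by (simp add: coord_def)
  show ?thesis
    unfolding hex_cell_def omega_powers[of "\<lambda>w. coord x y + w"] omega_powers[of "\<lambda>w. coord x y - w"]
      minus coord_add by (simp add: insert_commute)
qed

lemma benzel_hexagon_coord:
  "benzel_hexagon a b = convex hull {coord b a, coord (- a) (b - a), coord (a - b) (- b),
     coord (- a) (- b), coord b (b - a), coord (a - b) a}"
proof -
  have prod: "coord u v * coord x y = coord (u * x - v * y) (u * y + v * x - v * y)" for u v x y
  proof -
    have square: "omega * omega = - 1 - omega" by (simp add: complex_eq_iff omega_eq)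
    have "coord u v * coord x y =
        of_real (u * x) + of_real (u * y + v * x) * omega + of_real (v * y) * (omega * omega)"
      by (simp add: coord_def algebra_simps)
    then show ?thesis unfolding square by (simp add: coord_def algebra_simps)
  qed
  have vertices: "of_int a * omega + of_int b = coord b a" "of_int a + of_int b * omega = coord a b"
    by (simp_all add: coord_def)
  have minus: "- coord u v = coord (- u) (- v)" for u v by (simp add: coord_def)
  show ?thesis
    unfolding benzel_hexagon_def vertices
      omega_powers[of "\<lambda>w. w * coord (of_int b) (of_int a)"]
      omega_powers[of "\<lambda>w. - w * coord (of_int a) (of_int b)"] minus prod
    by (simp add: insert_commute algebra_simps)
qed

lemma linear_xcoord: "linear xcoord" and linear_ycoord: "linear ycoord"
  by (auto intro!: linearI simp: xcoord_def ycoord_def field_simps)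

lemma convex_coord_bounds:
  "convex {z. p \<le> xcoord z \<and> xcoord z \<le> q \<and> p' \<le> ycoord z \<and> ycoord z \<le> q' \<and>
     p'' \<le> xcoord z - ycoord z \<and> xcoord z - ycoord z \<le> q''}"
proof -
  have "convex (xcoord -` {p..q} \<inter> (ycoord -` {p'..q'} \<inter> (\<lambda>z. xcoord z - ycoord z) -` {p''..q''}))"
    by (intro convex_Int convex_linear_vimage linear_xcoord linear_ycoord linear_compose_sub
        convex_real_interval)
  also have "xcoord -` {p..q} \<inter> (ycoord -` {p'..q'} \<inter> (\<lambda>z. xcoord z - ycoord z) -` {p''..q''}) =
    {z. p \<le> xcoord z \<and> xcoord z \<le> q \<and> p' \<le> ycoord z \<and> ycoord z \<le> q' \<and>
     p'' \<le> xcoord z - ycoord z \<and> xcoord z - ycoord z \<le> q''}" by auto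
  finally show ?thesis .
qed

lemma hex_cell_bounds:
  assumes "z \<in> hex_cell (coord x y)"
  shows "x - 1 \<le> xcoord z \<and> xcoord z \<le> x + 1 \<and> y - 1 \<le> ycoord z \<and> ycoord z \<le> y + 1"
proof -
  have "hex_cell (coord x y) \<subseteq> {z. x - 1 \<le> xcoord z \<and> xcoord z \<le> x + 1 \<and> y - 1 \<le> ycoord z \<and>
      ycoord z \<le> y + 1 \<and> x - y - 1 \<le> xcoord z - ycoord z \<and> xcoord z - ycoord z \<le> x - y + 1}"
    unfolding hex_cell_coord by (rule hull_minimal) (auto intro: convex_coord_bounds)
  then show ?thesis using assms by auto
qed

lemma hex_cell_vertices:
  "{coord (x + 1) y, coord x (y + 1), coord (x - 1) (y - 1),
     coord (x - 1) y, coord x (y - 1), coord (x + 1) (y + 1)} \<subseteq> hex_cell (coord x y)"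
  unfolding hex_cell_coord by (rule hull_subset)

lemma hex_cell_eq_iff: "hex_cell (coord x y) = hex_cell (coord x' y') \<longleftrightarrow> x = x' \<and> y = y'"
proof
  assume eq: "hex_cell (coord x y) = hex_cell (coord x' y')"
  have le: "x \<le> x' \<and> y \<le> y'" if "hex_cell (coord x y) = hex_cell (coord x' y')" for x y x' y'
    using hex_cell_vertices[of x y] hex_cell_bounds[of "coord (x + 1) y" x' y']
      hex_cell_bounds[of "coord x (y + 1)" x' y'] that by auto
  show "x = x' \<and> y = y'" using le[OF eq] le[OF eq[symmetric]] by simp
qed simp

text \<open>The hypotheses on \<open>a\<close> and \<open>b\<close> keep each vertex on the correct
  side of all six lines; for example, they give \<open>b - a \<le> a\<close>.\<close>

lemma benzel_hexagon_bounds: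
  assumes "z \<in> benzel_hexagon a b" "b \<le> 2 * a" "a \<le> 2 * b"
  shows "- of_int a \<le> xcoord z \<and> xcoord z \<le> of_int b \<and> - of_int b \<le> ycoord z \<and> ycoord z \<le> of_int a \<and>
    - of_int b \<le> xcoord z - ycoord z \<and> xcoord z - ycoord z \<le> of_int a"
proof -
  have "real_of_int b \<le> 2 * real_of_int a" "real_of_int a \<le> 2 * real_of_int b"
    using assms(2,3) by linarith+
  then have "benzel_hexagon a b \<subseteq> {z. - of_int a \<le> xcoord z \<and> xcoord z \<le> of_int b \<and>
      - of_int b \<le> ycoord z \<and> ycoord z \<le> of_int a \<and>
      - of_int b \<le> xcoord z - ycoord z \<and> xcoord z - ycoord z \<le> of_int a}"
    unfolding benzel_hexagon_coord by (intro hull_minimal convex_coord_bounds) auto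
  then show ?thesis using assms(1) by auto
qed

lemma coord_segment:
  assumes "convex S" "coord x y \<in> S" "coord x' y' \<in> S" "0 \<le> t" "t \<le> 1"
  shows "coord ((1 - t) * x + t * x') ((1 - t) * y + t * y') \<in> S"
proof -
  have "(1 - t) *\<^sub>R coord x y + t *\<^sub>R coord x' y' \<in> S" using assms by (intro convexD) auto
  then show ?thesis by (simp add: scaleR_conv_of_real coord_scale coord_add flip: of_real_diff)
qed

text \<open>The point lies on a horizontal chord whose ends \<open>L\<close> and \<open>R\<close>
  divide the slanted sides in the same ratio. The bounds on \<open>x\<close> are cleared of
  denominators to suit the application.\<close>

lemma trapezoid_subset_convex:
  assumes S: "convex S" and "coord l y0 \<in> S" "coord r y0 \<in> S" "coord l' y1 \<in> S" "coord r' y1 \<in> S"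
    and y: "y0 \<le> y" "y \<le> y1" "y0 < y1"
    and x: "(y1 - y0) * x \<ge> (y1 - y) * l + (y - y0) * l'" "(y1 - y0) * x \<le> (y1 - y) * r + (y - y0) * r'"
  shows "coord x y \<in> S"
proof -
  define t where "t = (y - y0) / (y1 - y0)"
  have t: "0 \<le> t" "t \<le> 1" using y by (simp_all add: t_def)
  have t1: "1 - t = (y1 - y) / (y1 - y0)" using y by (simp add: t_def field_simps)
  have "(1 - t) * y0 + t * y1 = y0 + t * (y1 - y0)" by (simp add: algebra_simps)
  also have "\<dots> = y" using y by (simp add: t_def)
  finally have yt: "(1 - t) * y0 + t * y1 = y" .
  define L where "L = (1 - t) * l + t * l'"
  define R where "R = (1 - t) * r + t * r'"
  have "coord L y \<in> S" "coord R y \<in> S"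
    using coord_segment[OF S assms(2,4) t] coord_segment[OF S assms(3,5) t] by (simp_all add: yt L_def R_def)
  have "L \<le> x" "x \<le> R"
  proof -
    have "L = ((y1 - y) * l + (y - y0) * l') / (y1 - y0)" "R = ((y1 - y) * r + (y - y0) * r') / (y1 - y0)"
      unfolding L_def R_def t1 by (simp_all add: t_def add_divide_distrib)
    then show "L \<le> x" "x \<le> R" using x y by (simp_all add: pos_divide_le_eq pos_le_divide_eq mult.commute)
  qed
  show ?thesis
  \<comment> \<open>The chord can shrink to a point, where the ratio \<open>w\<close> would divide
    by zero.\<close>
  proof (cases "L = R")
    case True
    then show ?thesis using \<open>L \<le> x\<close> \<open>x \<le> R\<close> \<open>coord L y \<in> S\<close> by (metis antisym)
  next
    case False
    then have "L < R" using \<open>L \<le> x\<close> \<open>x \<le> R\<close> by simp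
    define w where "w = (x - L) / (R - L)"
    have w: "0 \<le> w" "w \<le> 1" using \<open>L \<le> x\<close> \<open>x \<le> R\<close> \<open>L < R\<close> by (simp_all add: w_def)
    have "(1 - w) * L + w * R = L + w * (R - L)" by (simp add: algebra_simps)
    also have "\<dots> = x" using \<open>L < R\<close> by (simp add: w_def)
    finally have "(1 - w) * L + w * R = x" .
    moreover have "(1 - w) * y + w * y = y" by (simp add: algebra_simps)
    ultimately show ?thesis
      using coord_segment[OF S \<open>coord L y \<in> S\<close> \<open>coord R y \<in> S\<close> w] by simp
  qed
qed

text \<open>The horizontal line through two opposite vertices cuts the hexagon into two trapezoids.\<close>

lemma coord_in_benzel_hexagon:
  assumes ab: "b < 2 * a" "a < 2 * b"
    and "- of_int a \<le> x" "x \<le> of_int b" "- of_int b \<le> y" "y \<le> of_int a" "- of_int b \<le> x - y" "x - y \<le> of_int a"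
  shows "coord x y \<in> benzel_hexagon a b"
proof -
  define A B where "A = real_of_int a" and "B = real_of_int b"
  have AB: "B < 2 * A" "A < 2 * B" using ab unfolding A_def B_def by linarith+
  note xy = assms(3-)[folded A_def B_def]
  have S: "convex (benzel_hexagon a b)" by (simp add: benzel_hexagon_def)
  have V: "coord B A \<in> benzel_hexagon a b" "coord (- A) (B - A) \<in> benzel_hexagon a b"
    "coord (A - B) (- B) \<in> benzel_hexagon a b" "coord (- A) (- B) \<in> benzel_hexagon a b"
    "coord B (B - A) \<in> benzel_hexagon a b" "coord (A - B) A \<in> benzel_hexagon a b"
    unfolding benzel_hexagon_coord A_def B_def by (auto intro: hull_inc)
  show ?thesis
  proof (cases "y \<le> B - A")
    case True
    show ?thesis
    proof (rule trapezoid_subset_convex[OF S V(4,3,2,5)])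
      \<comment> \<open>Each required bound is a side inequality multiplied by the height of the
        trapezoid, here \<open>2 * B - A\<close>.\<close>
      have "0 \<le> (2 * B - A) * (x + A)" using AB xy by simp
      then show "(B - A - y) * - A + (y - - B) * - A \<le> (B - A - - B) * x"
        by (simp add: algebra_simps)
      have "0 \<le> (2 * B - A) * (A - (x - y))" using AB xy by simp
      then show "(B - A - - B) * x \<le> (B - A - y) * (A - B) + (y - - B) * B"
        by (simp add: algebra_simps)
    qed (use True xy AB in auto)
  next
    case False
    show ?thesis
    proof (rule trapezoid_subset_convex[OF S V(2,5,6,1)])
      have "0 \<le> (2 * A - B) * (x - y + B)" using AB xy by simp
      then show "(A - y) * - A + (y - (B - A)) * (A - B) \<le> (A - (B - A)) * x"
        by (simp add: algebra_simps)
      have "0 \<le> (2 * A - B) * (B - x)" using AB xy by simp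
      then show "(A - (B - A)) * x \<le> (A - y) * B + (y - (B - A)) * B"
        by (simp add: algebra_simps)
    qed (use False xy AB in auto)
  qed
qed

text \<open>A cell reaches one unit from its center in each of the coordinates x, y and x - y, so
  every bound shrinks by one.\<close>

lemma hex_cell_subset_iff:
  assumes "b < 2 * a" "a < 2 * b"
  shows "hex_cell (coord (of_int x) (of_int y)) \<subseteq> benzel_hexagon a b \<longleftrightarrow>
    1 - a \<le> x \<and> x \<le> b - 1 \<and> 1 - b \<le> y \<and> y \<le> a - 1 \<and> 1 - b \<le> x - y \<and> x - y \<le> a - 1"
    (is "?L \<longleftrightarrow> ?R")
proof
  assume ?L
  then have in_hex: "coord (of_int x + 1) (of_int y) \<in> benzel_hexagon a b"
    "coord (of_int x - 1) (of_int y) \<in> benzel_hexagon a b"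
    "coord (of_int x) (of_int y + 1) \<in> benzel_hexagon a b"
    "coord (of_int x) (of_int y - 1) \<in> benzel_hexagon a b"
    using hex_cell_vertices[of "of_int x" "of_int y"] by auto
  have "b \<le> 2 * a" "a \<le> 2 * b" using assms by auto
  note bounds = benzel_hexagon_bounds[OF _ this]
  show ?R using bounds[OF in_hex(1)] bounds[OF in_hex(2)] bounds[OF in_hex(3)] bounds[OF in_hex(4)]
    unfolding xcoord_coord ycoord_coord by linarith
next
  assume R: ?R
  have "real_of_int (1 - a) \<le> x \<and> x \<le> real_of_int (b - 1) \<and> real_of_int (1 - b) \<le> y \<and>
      y \<le> real_of_int (a - 1) \<and> real_of_int (1 - b) \<le> real_of_int (x - y) \<and> real_of_int (x - y) \<le> real_of_int (a - 1)"
    using R unfolding of_int_le_iff .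
  moreover have "convex (benzel_hexagon a b)" by (simp add: benzel_hexagon_def)
  ultimately show ?L
    unfolding hex_cell_coord
    by (intro hull_minimal) (auto intro!: coord_in_benzel_hexagon assms)
qed

lemma cell_centers_coord:
  "cell_centers = {coord (of_int (1 + m + q)) (of_int (2 * q - m)) | m q. True}"
proof -
  have "1 + of_int m * (3/2 - of_real (sqrt 3) / 2 * \<i>) + of_int q * of_real (sqrt 3) * \<i> =
      coord (of_int (1 + m + q)) (of_int (2 * q - m))" for m q :: int
    by (simp add: complex_eq_iff Re_coord Im_coord field_simps)
  then show ?thesis unfolding cell_centers_def by simp
qed

lemma cells_in_benzel: "cells_in (benzel a b) = cells_in (benzel_hexagon a b)"
proof
  have "benzel a b \<subseteq> benzel_hexagon a b" unfolding benzel_def cells_in_def by auto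
  then show "cells_in (benzel a b) \<subseteq> cells_in (benzel_hexagon a b)" unfolding cells_in_def by auto
  show "cells_in (benzel_hexagon a b) \<subseteq> cells_in (benzel a b)" unfolding benzel_def cells_in_def by auto
qed

text \<open>Row 0 lies at y = 1 - b, the lowest possible height of a center. The offset in x makes x
  + y congruent to 1 modulo 3, as for all cell centers, and lets row 0 begin at p = 0.\<close>

definition center :: "nat \<Rightarrow> nat \<Rightarrow> nat \<times> nat \<Rightarrow> complex" where
  "center n k = (\<lambda>(r, p). coord (of_int (3 * int p - int r - int n - 3 * int k + 2))
     (of_int (int r + 2 - 2 * int n - 3 * int k)))"

lemma inj_hex_cell_center: "inj (hex_cell \<circ> center n k)"
  by (rule injI) (auto simp: center_def hex_cell_eq_iff)

lemma center_in_cell_centers: "center n k c \<in> cell_centers"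
proof (cases c)
  case (Pair r p)
  show ?thesis
    unfolding cell_centers_coord Pair center_def prod.case
    by (intro CollectI exI[of _ "2 * int p - int k - int r"] exI[of _ "int p - int n - 2 * int k + 1"])
       (simp add: coord_eq_iff)
qed

lemma cells_in_benzel_hexagon:
  assumes "n \<ge> 1" and a: "a = int n + 3 * int k" and b: "b = 2 * int n + 3 * int k - 1"
  shows "cells_in (benzel_hexagon a b) = (hex_cell \<circ> center n k) ` region n k"
proof (intro equalityI subsetI)
  have ab: "b < 2 * a" "a < 2 * b" using assms by auto
  fix C assume "C \<in> cells_in (benzel_hexagon a b)"
  then obtain m q where C: "C = hex_cell (coord (of_int (1 + m + q)) (of_int (2 * q - m)))"
    and sub: "C \<subseteq> benzel_hexagon a b"
    unfolding cells_in_def cell_centers_coord by auto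
  note bounds = sub[unfolded C hex_cell_subset_iff[OF ab], unfolded a b]
  \<comment> \<open>These formulas invert \<open>center\<close>; the bounds make both integers
    nonnegative, so \<open>nat\<close> loses nothing.\<close>
  define r p where "r = nat (2 * q - m - 2 + 2 * int n + 3 * int k)" and "p = nat (q + int n + 2 * int k - 1)"
  have r: "int r = 2 * q - m - 2 + 2 * int n + 3 * int k" and p: "int p = q + int n + 2 * int k - 1"
    using bounds unfolding r_def p_def by linarith+
  have "C = (hex_cell \<circ> center n k) (r, p)"
    unfolding C center_def comp_def prod.case r p by (simp add: algebra_simps)
  moreover have "(r, p) \<in> region n k"
  proof -
    have "int r \<le> 3 * int p + 1 \<and> 3 * int p + 1 \<le> 3 * int k + 2 * int r \<and>
        3 * int p + 4 \<le> 3 * int n + 6 * int k + int r \<and>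
        2 * int r + 2 \<le> 3 * int p + 3 * int n + 3 * int k \<and> int r + 3 \<le> 3 * int n + 6 * int k"
      using bounds unfolding r p by auto
    then show ?thesis unfolding region_def by auto
  qed
  ultimately show "C \<in> (hex_cell \<circ> center n k) ` region n k" by blast
next
  have ab: "b < 2 * a" "a < 2 * b" using assms by auto
  fix C assume "C \<in> (hex_cell \<circ> center n k) ` region n k"
  then obtain r p where rp: "(r, p) \<in> region n k" and C: "C = hex_cell (center n k (r, p))" by auto
  have "hex_cell (center n k (r, p)) \<subseteq> benzel_hexagon a b"
    unfolding center_def prod.case hex_cell_subset_iff[OF ab] using rp unfolding region_def a b by auto
  then show "C \<in> cells_in (benzel_hexagon a b)"
    using center_in_cell_centers unfolding C cells_in_def by auto
qed

lemma center_steps: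
  "center n k (r + 1, p + 1) = center n k (r, p) + coord 2 1"
  "center n k (r + 2, p + 1 + 1) = center n k (r, p) + coord 4 2"
  "center n k (r + 2, p + 1 + 0) = center n k (r, p) + coord 1 2"
  "center n k (r + 1, p + 0) = center n k (r, p) + coord (-1) 1"
  "center n k (r + 2, p + 0 + 0) = center n k (r, p) + coord (-2) 2"
  by (simp_all add: center_def coord_add coord_eq_iff)

text \<open>A falling bone is anchored at its upper left cell, which is the last cell of the tile,
  two rows up.\<close>

lemma image_tiles:
  "(hex_cell \<circ> center n k) ` tile r p 1 1 = rising_bone (center n k (r, p))"
  "(hex_cell \<circ> center n k) ` tile r p 1 0 = right_stone (center n k (r, p))"
  "(hex_cell \<circ> center n k) ` tile r p 0 0 = falling_bone (center n k (r, p) + coord (-2) 2)"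
proof -
  have two: "2 * coord x y = coord (2 * x) (2 * y)" for x y
    using coord_scale[of 2 x y] by simp
  show "(hex_cell \<circ> center n k) ` tile r p 1 1 = rising_bone (center n k (r, p))"
    "(hex_cell \<circ> center n k) ` tile r p 1 0 = right_stone (center n k (r, p))"
    "(hex_cell \<circ> center n k) ` tile r p 0 0 = falling_bone (center n k (r, p) + coord (-2) 2)"
    unfolding rising_bone_def right_stone_def falling_bone_def coord_constants two tile_def
      image_insert image_empty comp_apply center_steps
    unfolding add.assoc coord_add
    by (simp_all add: coord_zero insert_commute)
qed

text \<open>\<open>center\<close> reaches only part of the grid. Containment of \<open>t\<close> in
  the image provides natural coordinates for its lowest cell, and these determine the tile.\<close>

lemma allowed_tiles_iff:
  assumes "t \<subseteq> (hex_cell \<circ> center n k) ` R"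
  shows "t \<in> right_stones \<union> rising_bones \<union> falling_bones \<longleftrightarrow> t \<in> (`) (hex_cell \<circ> center n k) ` tiles"
proof
  have lowest: "\<exists>r p. c = center n k (r, p)"
    if c: "hex_cell c \<in> t" "c = coord x y" for c x y
  proof -
    obtain r p where "hex_cell c = hex_cell (center n k (r, p))"
      using subsetD[OF assms c(1)] by auto
    then show ?thesis unfolding c(2) center_def prod.case hex_cell_eq_iff by blast
  qed
  assume "t \<in> right_stones \<union> rising_bones \<union> falling_bones"
  then consider c where "c \<in> cell_centers" "t = right_stone c" | c where "c \<in> cell_centers" "t = rising_bone c"
    | c where "c \<in> cell_centers" "t = falling_bone c"
    unfolding right_stones_def rising_bones_def falling_bones_def by auto
  then show "t \<in> (`) (hex_cell \<circ> center n k) ` tiles"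
  proof cases
    case 1
    obtain x y where "c = coord x y" using 1(1) unfolding cell_centers_coord by auto
    moreover have "hex_cell c \<in> t" by (simp add: 1(2) right_stone_def)
    ultimately obtain r p where "c = center n k (r, p)" using lowest by blast
    then have "t = (hex_cell \<circ> center n k) ` tile r p 1 0" unfolding 1(2) image_tiles by simp
    moreover have "tile r p 1 0 \<in> tiles" by (force simp: tiles_def)
    ultimately show ?thesis by blast
  next
    case 2
    obtain x y where "c = coord x y" using 2(1) unfolding cell_centers_coord by auto
    moreover have "hex_cell c \<in> t" by (simp add: 2(2) rising_bone_def)
    ultimately obtain r p where "c = center n k (r, p)" using lowest by blast
    then have "t = (hex_cell \<circ> center n k) ` tile r p 1 1" unfolding 2(2) image_tiles by simp
    moreover have "tile r p 1 1 \<in> tiles" by (force simp: tiles_def)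
    ultimately show ?thesis by blast
  next
    case 3
    obtain x y where c: "c = coord x y" using 3(1) unfolding cell_centers_coord by auto
    have "c + 2 * coord 1 (-1) = coord (x + 2) (y - 2)"
      using coord_scale[of 2 1 "-1"] by (simp add: c coord_add)
    moreover have "hex_cell (c + 2 * coord 1 (-1)) \<in> t"
      unfolding 3(2) falling_bone_def coord_constants by blast
    ultimately obtain r p where "coord (x + 2) (y - 2) = center n k (r, p)" using lowest by metis
    then have "c = center n k (r, p) + coord (-2) 2" by (simp add: c coord_add flip: \<open>coord _ _ = _\<close>)
    then have "t = (hex_cell \<circ> center n k) ` tile r p 0 0" unfolding 3(2) image_tiles by simp
    moreover have "tile r p 0 0 \<in> tiles" by (force simp: tiles_def)
    ultimately show ?thesis by blast
  qed
next
  assume "t \<in> (`) (hex_cell \<circ> center n k) ` tiles"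
  then obtain r p d e where t: "t = (hex_cell \<circ> center n k) ` tile r p d e" and de: "e \<le> d" "d \<le> 1"
    unfolding tiles_def by auto
  have "center n k (r, p) + coord (-2) 2 = center n k (r + 2, p)"
    using center_steps(5)[of n k r p] by simp
  then have "falling_bone (center n k (r, p) + coord (-2) 2) \<in> falling_bones"
    unfolding falling_bones_def using center_in_cell_centers by simp
  moreover have "rising_bone (center n k (r, p)) \<in> rising_bones" "right_stone (center n k (r, p)) \<in> right_stones"
    unfolding rising_bones_def right_stones_def using center_in_cell_centers by auto
  moreover have "(d = 1 \<and> e = 1) \<or> (d = 1 \<and> e = 0) \<or> (d = 0 \<and> e = 0)" using de by auto
  ultimately show "t \<in> right_stones \<union> rising_bones \<union> falling_bones"
    unfolding t using image_tiles[of n k r p] by (elim disjE conjE) (simp_all only: Un_iff simp_thms)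
qed

lemma card_partitions_image:
  assumes f: "inj f" and T: "\<And>t. t \<subseteq> f ` R \<Longrightarrow> t \<in> T \<longleftrightarrow> t \<in> (`) f ` tiles"
  shows "card {P. partition_on (f ` R) P \<and> P \<subseteq> T} = card (cell_tilings R)"
proof (rule bij_betw_same_card[symmetric])
  let ?F = "(`) ((`) f)"
  have inj_image: "inj ((`) f)" using f by (simp add: inj_image_eq_iff inj_def)
  have part: "partition_on (f ` R) (?F Q) \<longleftrightarrow> partition_on R Q" for Q
  proof -
    have "\<Union> (?F Q) = f ` \<Union> Q" by auto
    then have "\<Union> (?F Q) = f ` R \<longleftrightarrow> \<Union> Q = R" using inj_image_eq_iff[OF f] by simp
    moreover have "disjoint (?F Q) \<longleftrightarrow> disjoint Q"
      unfolding disjoint_def using f inj_image_eq_iff[OF f] by (auto simp flip: image_Int)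
    ultimately show ?thesis by (auto simp: partition_on_def)
  qed
  have T_iff: "?F Q \<subseteq> T \<longleftrightarrow> Q \<subseteq> tiles" if "partition_on R Q" for Q
  proof -
    have "f ` t \<in> T \<longleftrightarrow> t \<in> tiles" if "t \<in> Q" for t
    proof -
      have "f ` t \<subseteq> f ` R" using that \<open>partition_on R Q\<close> by (auto simp: partition_on_def)
      then show ?thesis using T inj_image by (simp add: inj_image_mem_iff)
    qed
    then show ?thesis by auto
  qed
  show "bij_betw ?F (cell_tilings R) {P. partition_on (f ` R) P \<and> P \<subseteq> T}"
    unfolding bij_betw_def
  proof
    show "inj_on ?F (cell_tilings R)"
      using inj_image by (auto intro!: inj_onI simp: inj_image_eq_iff)
    show "?F ` cell_tilings R = {P. partition_on (f ` R) P \<and> P \<subseteq> T}"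
    proof (intro equalityI subsetI)
      fix P assume "P \<in> ?F ` cell_tilings R"
      then show "P \<in> {P. partition_on (f ` R) P \<and> P \<subseteq> T}"
        using part T_iff unfolding cell_tilings_def by auto
    next
      fix P assume P: "P \<in> {P. partition_on (f ` R) P \<and> P \<subseteq> T}"
      have "P \<subseteq> (`) f ` tiles"
      proof
        fix t assume "t \<in> P"
        then have "t \<subseteq> f ` R" "t \<in> T" using P by (auto simp: partition_on_def)
        then show "t \<in> (`) f ` tiles" using T by blast
      qed
      then obtain Q where Q: "P = ?F Q" by (metis subset_image_iff)
      then have "Q \<in> cell_tilings R" using P part T_iff unfolding cell_tilings_def by auto
      then show "P \<in> ?F ` cell_tilings R" using Q by blast
    qed
  qed
qed

theorem theorem1p1:
  fixes a b :: int and n k :: nat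
  assumes "2 \<le> a" and "a \<le> b" and "b \<le> 2 * a"
    and "[a + b = 2] (mod 3)"
    and "int n = b + 1 - a"
    and "real k = real_of_int (2 * a - b - 1) / 3"
  shows "real (card (tilings (right_stones \<union> rising_bones \<union> falling_bones) (benzel a b))) =
    (\<Prod>j = 1..k. (fact (2 * j) * fact (2 * j + 2 * n - 2)) /
                 (fact (j + n - 1) * fact (j + n + k - 1)))"
proof -
  have "real_of_int (3 * int k) = real_of_int (2 * a - b - 1)" using assms(6) by simp
  then have "3 * int k = 2 * a - b - 1" by linarith
  then have ab: "a = int n + 3 * int k" "b = 2 * int n + 3 * int k - 1" using assms(5) by linarith+
  have n: "n \<ge> 1" using assms(2,5) by linarith
  have "tilings (right_stones \<union> rising_bones \<union> falling_bones) (benzel a b) =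
      {P. partition_on ((hex_cell \<circ> center n k) ` region n k) P \<and>
          P \<subseteq> right_stones \<union> rising_bones \<union> falling_bones}"
    unfolding tilings_def cells_in_benzel cells_in_benzel_hexagon[OF n ab] ..
  also have "card \<dots> = card (cell_tilings (region n k))"
    by (rule card_partitions_image[OF inj_hex_cell_center allowed_tiles_iff])
  finally show ?thesis by (simp only: card_cell_tilings_region[OF n])
qed

end
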